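(* Let $K$ be a finite field and let $d$ be an integer with $\gcd(d,|K|-1)=1$. Suppose that $I$ and $J$ are subfields of $K$ with $[J:I]=2$, such that $d$ is degenerate over $I$ but not degenerate over $J$. Then the set $\{W_{K,d}(a): a\in K^\times\}$ is not of the form $\{-A,0,+A\}$ for any $A$.
   Context: For a finite field $F$ of characteristic $p$, $\psi_F(x)=\exp(2\pi i\,\mathrm{Tr}_{F/\mathbb{F}_p}(x)/p)$ is the canonical additive character. For $d$ with $\gcd(d,|K|-1)=1$ and $a\in K$, the Weil sum is $W_{K,d}(a)=\sum_{x\in K}\psi_K(x^d+ax)$. For a subfield $F$ of $K$ (of characteristic $p$), $d$ is called degenerate over $F$ if $d\equiv p^j \pmod{|F|-1}$ for some integer $j$. *)

theory Defs
  imports "HOL-Analysis.Analysis" "HOL-Number_Theory.Cong"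
begin

definition subfield :: "'a::field set \<Rightarrow> bool" where
  "subfield F \<longleftrightarrow> 0 \<in> F \<and> 1 \<in> F \<and>
     (\<forall>x\<in>F. \<forall>y\<in>F. x + y \<in> F \<and> x * y \<in> F) \<and>
     (\<forall>x\<in>F. - x \<in> F \<and> inverse x \<in> F)"

definition field_deg :: "'a::{finite,field} itself \<Rightarrow> nat" where
  "field_deg _ = (THE n. CARD('a) = CHAR('a) ^ n)"

definition abs_trace :: "'a::{finite,field} \<Rightarrow> 'a" where
  "abs_trace x = (\<Sum>i<field_deg TYPE('a). x ^ (CHAR('a) ^ i))"

text \<open>Canonical additive character: the trace lies in the prime field, identified
  with {0..p-1} via of_nat.\<close>
definition psi :: "'a::{finite,field} \<Rightarrow> complex" where
  "psi x = exp (2 * pi * \<i> * of_nat (THE k. k < CHAR('a) \<and> of_nat k = abs_trace x)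
                  / of_nat CHAR('a))"

definition weil_sum :: "int \<Rightarrow> 'a::{finite,field} \<Rightarrow> complex" where
  "weil_sum d a = (\<Sum>x\<in>UNIV. psi (x powi d + a * x))"

definition degenerate :: "int \<Rightarrow> 'a::{finite,field} set \<Rightarrow> bool" where
  "degenerate d F \<longleftrightarrow> (\<exists>j::nat. [d = int (CHAR('a)) ^ j] (mod (int (card F) - 1)))"

end

(* Write I = F_r, J = F_Q with Q = r^2 and K = F_q with q = Q^m, and let W_K and W_J be the Weil sums
   of the exponent over K and over J. If W_K takes the values -A, 0, A, then its first three power
   moments force A = r^m B (up to sign) with B divisible by the characteristic p.

   By the Davenport-Hasse relation the Gauss sums of characters of K that factor through the norm
   to J are, up to sign, m-th powers of Gauss sums over J. The signs cancel in W, so the sum of W_K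
   over a fibre of the norm is the m-fold multiplicative convolution power of W_J. Hence this
   convolution power is divisible by p r^m. Since d is a power of p modulo r - 1, Niho's argument
   gives (r - 1) W_J = r w with w integral, and the convolution power of w vanishes modulo p. The
   group algebra of the group of units of J in characteristic p is reduced, so p divides w.
   By the shape of w this makes w nonnegative, and the first two moments of W_J then force
   W_J(b) = Q for some b. Comparing monomials, x^d is a power of the Frobenius map on J. *)
theory Submission
  imports "HOL-Algebra.Algebraic_Closure_Type" Defs
begin

section \<open>Multiplicative convolution\<close>

text \<open>Complex multiplicative characters of \<open>J\<close> never occur. A character turns
  convolution into multiplication, so a family of identities between products of Gauss sums, one for
  each character, becomes one identity between convolutions. \<open>conv\<close> allows any
  commutative ring, and the identity is read over the complex numbers, over the integers and in the
  finite field itself. The last reading carries the reduction modulo p: as p does not divide |J| -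
  1, the powers \<open>b ^ j\<close> are enough for Fourier inversion, and a Fourier coefficient
  whose m-th power vanishes in a field vanishes.

  The factor p beyond r^m comes from W_K(0) = 0: W_K cannot be nonzero everywhere, which excludes
  A^2 = q. This single p suffices because w + r counts a set that contains 0 and is stable under
  multiplication by I. Its size is 1 or at least r, and divisibility by p excludes 1. The last input
  is a coincidence of moments: with S = (r - 1) r, the values of w have sum S and sum of squares
  S^2.\<close>

definition conv :: "'b::field set \<Rightarrow> ('b \<Rightarrow> 'c::comm_ring_1) \<Rightarrow> ('b \<Rightarrow> 'c) \<Rightarrow> 'b \<Rightarrow> 'c" where
  "conv G f g t = (\<Sum>s\<in>G. f s * g (t / s))"

primrec conv_pow :: "'b::field set \<Rightarrow> ('b \<Rightarrow> 'c::comm_ring_1) \<Rightarrow> nat \<Rightarrow> 'b \<Rightarrow> 'c" where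
  "conv_pow G f 0 = (\<lambda>t. if t = 1 then 1 else 0)"
| "conv_pow G f (Suc n) = conv G f (conv_pow G f n)"

text \<open>A set inside a field type rather than a type of its own: it is used for the units of
  several subfields and, in the algebraic closure, of a fixed field of Frobenius.\<close>

locale finite_mult_group =
  fixes G :: "'b::field set"
  assumes finite_G [simp]: "finite G"
    and zero_notin [simp]: "0 \<notin> G"
    and one_in [simp]: "1 \<in> G"
    and mult_in [simp]: "x \<in> G \<Longrightarrow> y \<in> G \<Longrightarrow> x * y \<in> G"
    and inverse_in [simp]: "x \<in> G \<Longrightarrow> inverse x \<in> G"
begin

lemma nonzero: "x \<in> G \<Longrightarrow> x \<noteq> 0"
  using zero_notin by blast

lemma divide_in [simp]: "x \<in> G \<Longrightarrow> y \<in> G \<Longrightarrow> x / y \<in> G"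
  by (simp add: divide_inverse)

lemma power_in [simp]: "x \<in> G \<Longrightarrow> x ^ n \<in> G"
  by (induction n) auto

lemma sum_divide_shift:
  assumes "u \<in> G" shows "(\<Sum>s\<in>G. f (s / u)) = (\<Sum>s\<in>G. f s)"
  by (rule sum.reindex_bij_witness[where i = "\<lambda>s. s * u" and j = "\<lambda>s. s / u"])
     (use assms nonzero in auto)

lemma sum_divide_reflect:
  assumes "u \<in> G" shows "(\<Sum>s\<in>G. f (u / s)) = (\<Sum>s\<in>G. f s)"
  by (rule sum.reindex_bij_witness[where i = "\<lambda>s. u / s" and j = "\<lambda>s. u / s"])
     (use assms nonzero in auto)

lemma conv_cong:
  assumes "\<And>s. s \<in> G \<Longrightarrow> f s = f' s" "\<And>s. s \<in> G \<Longrightarrow> g s = g' s" "t \<in> G"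
  shows "conv G f g t = conv G f' g' t"
  unfolding conv_def using assms by (intro sum.cong) auto

lemma conv_commute:
  assumes "t \<in> G" shows "conv G f g t = conv G g f t"
proof -
  have "conv G g f t = (\<Sum>s\<in>G. (\<lambda>s. g s * f (t / s)) (t / s))"
    unfolding conv_def by (rule sum_divide_reflect[OF assms, symmetric])
  also have "\<dots> = conv G f g t"
    unfolding conv_def using assms nonzero by (intro sum.cong) (auto simp: mult.commute)
  finally show ?thesis by simp
qed

lemma conv_assoc:
  assumes "t \<in> G" shows "conv G (conv G f g) h t = conv G f (conv G g h) t"
proof -
  have "conv G (conv G f g) h t = (\<Sum>u\<in>G. \<Sum>s\<in>G. f s * g (u / s) * h (t / u))"
    by (simp add: conv_def sum_distrib_right)
  also have "\<dots> = (\<Sum>s\<in>G. \<Sum>u\<in>G. f s * g (u / s) * h (t / u))"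
    by (rule sum.swap)
  also have "\<dots> = (\<Sum>s\<in>G. \<Sum>u\<in>G. f s * g u * h (t / s / u))"
  proof (rule sum.cong[OF refl])
    fix s assume s: "s \<in> G"
    have "(\<Sum>u\<in>G. f s * g (u / s) * h (t / u)) = (\<Sum>u\<in>G. (\<lambda>u. f s * g u * h (t / s / u)) (u / s))"
      using s nonzero by (intro sum.cong) auto
    also have "\<dots> = (\<Sum>u\<in>G. f s * g u * h (t / s / u))"
      by (rule sum_divide_shift[OF s])
    finally show "(\<Sum>u\<in>G. f s * g (u / s) * h (t / u)) = (\<Sum>u\<in>G. f s * g u * h (t / s / u))" .
  qed
  also have "\<dots> = conv G f (conv G g h) t"
    by (simp add: conv_def sum_distrib_left mult.assoc)
  finally show ?thesis .
qed

lemma conv_delta_right: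
  assumes "t \<in> G" shows "conv G f (\<lambda>t. if t = 1 then 1 else 0) t = f t"
proof -
  have "conv G f (\<lambda>t. if t = 1 then 1 else 0) t = (\<Sum>s\<in>G. if s = t then f s else 0)"
    unfolding conv_def using assms nonzero by (intro sum.cong) (auto simp: divide_eq_1_iff)
  also have "\<dots> = f t" using assms by simp
  finally show ?thesis .
qed

lemma conv_pow_cong:
  assumes "\<And>s. s \<in> G \<Longrightarrow> f s = g s" "t \<in> G"
  shows "conv_pow G f n t = conv_pow G g n t"
  using assms(2)
proof (induction n arbitrary: t)
  case (Suc n)
  then show ?case unfolding conv_pow.simps by (intro conv_cong) (auto simp: assms(1))
qed auto

lemma conv_pow_conv:
  assumes "t \<in> G"
  shows "conv_pow G (conv G f g) n t = conv G (conv_pow G f n) (conv_pow G g n) t"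
  using assms
proof (induction n arbitrary: t)
  case 0
  then show ?case by (simp only: conv_pow.simps conv_delta_right)
next
  case (Suc n)
  let ?F = "conv_pow G f n" and ?H = "conv_pow G g n"
  have "conv_pow G (conv G f g) (Suc n) t = conv G (conv G f g) (conv G ?F ?H) t"
    using Suc by (auto intro: conv_cong)
  also have "\<dots> = conv G f (conv G g (conv G ?F ?H)) t"
    by (rule conv_assoc[OF Suc.prems])
  also have "\<dots> = conv G f (conv G ?F (conv G g ?H)) t"
  proof (rule conv_cong[OF refl _ Suc.prems])
    fix s assume s: "s \<in> G"
    have "conv G g (conv G ?F ?H) s = conv G (conv G g ?F) ?H s"
      by (rule conv_assoc[OF s, symmetric])
    also have "\<dots> = conv G (conv G ?F g) ?H s"
      by (rule conv_cong[OF conv_commute refl s])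
    also have "\<dots> = conv G ?F (conv G g ?H) s" by (rule conv_assoc[OF s])
    finally show "conv G g (conv G ?F ?H) s = conv G ?F (conv G g ?H) s" .
  qed
  also have "\<dots> = conv G (conv G f ?F) (conv G g ?H) t"
    by (rule conv_assoc[OF Suc.prems, symmetric])
  finally show ?case by simp
qed

lemma conv_pow_scale:
  assumes "t \<in> G"
  shows "conv_pow G (\<lambda>s. c * f s) n t = c ^ n * conv_pow G f n t"
  using assms
proof (induction n arbitrary: t)
  case (Suc n)
  then show ?case by (simp add: conv_def sum_distrib_left mult_ac)
qed auto

text \<open>Summation against a multiplicative \<open>\<kappa>\<close> is a ring homomorphism on the
  group algebra. It is used with the trivial character over the complex numbers and with
  \<open>t ^ j\<close> in characteristic p.\<close>

lemma sum_conv_pow: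
  assumes "\<And>x y. x \<in> G \<Longrightarrow> y \<in> G \<Longrightarrow> \<kappa> (x * y) = \<kappa> x * \<kappa> y" "\<kappa> 1 = 1"
  shows "(\<Sum>t\<in>G. \<kappa> t * conv_pow G f n t) = (\<Sum>t\<in>G. \<kappa> t * f t) ^ n"
proof (induction n)
  case 0
  have "(\<Sum>t\<in>G. \<kappa> t * conv_pow G f 0 t) = (\<Sum>t\<in>G. if t = 1 then \<kappa> 1 else 0)"
    by (intro sum.cong) auto
  then show ?case using assms(2) by simp
next
  case (Suc n)
  let ?F = "conv_pow G f n"
  have "(\<Sum>t\<in>G. \<kappa> t * conv_pow G f (Suc n) t) = (\<Sum>t\<in>G. \<Sum>s\<in>G. \<kappa> t * (f s * ?F (t / s)))"
    by (simp add: conv_def sum_distrib_left)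
  also have "\<dots> = (\<Sum>s\<in>G. \<Sum>t\<in>G. \<kappa> t * (f s * ?F (t / s)))"
    by (rule sum.swap)
  also have "\<dots> = (\<Sum>s\<in>G. \<Sum>t\<in>G. \<kappa> s * f s * (\<kappa> t * ?F t))"
  proof (rule sum.cong[OF refl])
    fix s assume s: "s \<in> G"
    have "(\<Sum>t\<in>G. \<kappa> t * (f s * ?F (t / s))) = (\<Sum>t\<in>G. (\<lambda>t. \<kappa> s * f s * (\<kappa> t * ?F t)) (t / s))"
    proof (rule sum.cong[OF refl])
      fix t assume t: "t \<in> G"
      have "\<kappa> t = \<kappa> s * \<kappa> (t / s)"
        using assms(1)[of s "t / s"] s t nonzero[OF s] by simp
      then show "\<kappa> t * (f s * ?F (t / s)) = (\<lambda>t. \<kappa> s * f s * (\<kappa> t * ?F t)) (t / s)"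
        by (simp add: mult_ac)
    qed
    also have "\<dots> = (\<Sum>t\<in>G. \<kappa> s * f s * (\<kappa> t * ?F t))"
      by (rule sum_divide_shift[OF s])
    finally show "(\<Sum>t\<in>G. \<kappa> t * (f s * ?F (t / s))) = (\<Sum>t\<in>G. \<kappa> s * f s * (\<kappa> t * ?F t))" .
  qed
  also have "\<dots> = (\<Sum>s\<in>G. \<kappa> s * f s) * (\<Sum>t\<in>G. \<kappa> t * ?F t)"
    by (simp add: sum_product)
  finally show ?case using Suc by simp
qed

text \<open>A group automorphism extends to a ring automorphism of the group algebra. The one needed
  later is \<open>(1 / s) ^ e\<close>.\<close>

lemma conv_pow_automorphism:
  assumes bij: "bij_betw \<sigma> G G" and hom: "\<And>x y. x \<in> G \<Longrightarrow> y \<in> G \<Longrightarrow> \<sigma> (x / y) = \<sigma> x / \<sigma> y"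
    and t: "t \<in> G"
  shows "conv_pow G (\<lambda>s. f (\<sigma> s)) n t = conv_pow G f n (\<sigma> t)"
  using t
proof (induction n arbitrary: t)
  case 0
  have 1: "\<sigma> 1 = 1" using hom[of 1 1] bij one_in nonzero bij_betwE by fastforce
  have "\<sigma> t = 1 \<longleftrightarrow> t = 1"
    using bij 0 one_in 1 unfolding bij_betw_def inj_on_def by metis
  then show ?case by simp
next
  case (Suc n)
  have "conv_pow G (\<lambda>s. f (\<sigma> s)) (Suc n) t = (\<Sum>s\<in>G. (\<lambda>s. f s * conv_pow G f n (\<sigma> t / s)) (\<sigma> s))"
    using Suc by (auto simp: conv_def hom intro!: sum.cong)
  also have "\<dots> = (\<Sum>s\<in>G. f s * conv_pow G f n (\<sigma> t / s))"
    by (rule sum.reindex_bij_betw[OF bij])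
  finally show ?case by (simp add: conv_def)
qed

text \<open>Convolution with a constant function only sees the total mass.\<close>

lemma conv_pow_add_const:
  assumes "t \<in> G" "u \<in> G"
  shows "conv_pow G (\<lambda>s. f s + c) n t - conv_pow G f n t =
         conv_pow G (\<lambda>s. f s + c) n u - conv_pow G f n u"
  using assms
proof (induction n arbitrary: t u)
  case (Suc n)
  let ?P = "conv_pow G (\<lambda>s. f s + c) n" and ?F = "conv_pow G f n"
  have "conv_pow G (\<lambda>s. f s + c) (Suc n) t - conv_pow G f (Suc n) t
        = (\<Sum>s\<in>G. (f s + c) * (?P 1 - ?F 1)) + c * (\<Sum>s\<in>G. ?F s)" if t: "t \<in> G" for t
  proof -
    have "conv_pow G (\<lambda>s. f s + c) (Suc n) t - conv_pow G f (Suc n) t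
      = (\<Sum>s\<in>G. (f s + c) * (?P (t / s) - ?F (t / s))) + c * (\<Sum>s\<in>G. ?F (t / s))"
      by (simp add: conv_def algebra_simps sum.distrib sum_subtractf sum_distrib_left)
    also have "(\<Sum>s\<in>G. ?F (t / s)) = (\<Sum>s\<in>G. ?F s)"
      by (rule sum_divide_reflect[OF t])
    also have "(\<Sum>s\<in>G. (f s + c) * (?P (t / s) - ?F (t / s))) = (\<Sum>s\<in>G. (f s + c) * (?P 1 - ?F 1))"
      using Suc.IH[of "t / s" 1 for s] t by (intro sum.cong) auto
    finally show ?thesis .
  qed
  then show ?case using Suc.prems by simp
qed auto

end

section \<open>The Davenport-Hasse relation\<close>

lemma power_CHAR_power_inj:
  fixes x y :: "'b::field"
  assumes "prime CHAR('b)" "x ^ (CHAR('b) ^ h) = y ^ (CHAR('b) ^ h)"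
  shows "x = y"
proof -
  have "(x - y + y) ^ (CHAR('b) ^ h) = (x - y) ^ (CHAR('b) ^ h) + y ^ (CHAR('b) ^ h)"
    by (rule freshmans_dream'[OF assms(1) refl])
  then have "(x - y) ^ (CHAR('b) ^ h) = 0" using assms(2) by simp
  then show ?thesis by simp
qed

text \<open>These are roots of X^n - X. The bound identifies a subfield of order n with this set,
  both in the finite field and in the algebraic closure.\<close>

lemma finite_power_fixed:
  assumes "n > 1" shows "finite {x :: 'b::field. x ^ n = x}"
    and "card {x :: 'b::field. x ^ n = x} \<le> n"
proof -
  let ?p = "Polynomial.monom 1 n - Polynomial.monom 1 1 :: 'b poly"
  have deg: "Polynomial.degree ?p \<le> n"
    using assms by (intro degree_diff_le) (auto simp: degree_monom_eq)
  have "Polynomial.coeff ?p n = 1" using assms by simp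
  then have nz: "?p \<noteq> 0" by (metis coeff_0 zero_neq_one)
  have eq: "{x :: 'b. x ^ n = x} = {x. poly ?p x = 0}" by (auto simp: poly_monom)
  show "finite {x :: 'b::field. x ^ n = x}"
    unfolding eq by (rule poly_roots_finite[OF nz])
  show "card {x :: 'b::field. x ^ n = x} \<le> n"
    unfolding eq using card_poly_roots_bound[OF nz] deg by linarith
qed

section \<open>Polynomials with a prescribed multiset of roots\<close>

definition linear_prod :: "'b::field multiset \<Rightarrow> 'b poly" where
  "linear_prod D = (\<Prod>x\<in>#D. [:- x, 1:])"

lemma linear_prod_empty [simp]: "linear_prod {#} = 1"
  and linear_prod_add [simp]: "linear_prod (add_mset x D) = [:- x, 1:] * linear_prod D"
  by (simp_all add: linear_prod_def)

lemma linear_prod_nonzero: "linear_prod D \<noteq> 0"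
  by (auto simp: linear_prod_def)

lemma degree_linear_prod [simp]: "Polynomial.degree (linear_prod D) = size D"
  by (induction D) (auto simp: degree_mult_eq linear_prod_nonzero simp del: mult_pCons_left)

lemma lead_coeff_linear_prod [simp]: "lead_coeff (linear_prod D) = 1"
  by (induction D) (auto simp: lead_coeff_mult simp del: mult_pCons_left degree_linear_prod)

lemma proots_linear_prod [simp]: "proots (linear_prod D) = D"
  by (induction D) (simp_all add: proots_mult linear_prod_nonzero proots_linear_factor del: mult_pCons_left)

lemma coeff_0_linear_prod: "Polynomial.coeff (linear_prod D) 0 = (- 1) ^ size D * prod_mset D"
  by (induction D) (auto simp: coeff_mult simp del: mult_pCons_left)

lemma coeff_penultimate_linear_prod:
  "D \<noteq> {#} \<Longrightarrow> Polynomial.coeff (linear_prod D) (size D - 1) = - sum_mset D"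
proof (induction D)
  case (add x D)
  show ?case
  proof (cases "D = {#}")
    case False
    then obtain k where k: "size D = Suc k" by (cases "size D") auto
    have "Polynomial.coeff (linear_prod D) (Suc k) = 1"
      using lead_coeff_linear_prod[of D] k by simp
    with add False k show ?thesis by simp
  qed simp
qed simp

text \<open>The Davenport-Hasse relation for the group algebra of the multiplicative group of the
  fixed field of \<open>x \<mapsto> x ^ Q\<close>: Frobenius-stable multisets are the root multisets of the monic
  polynomials over this field, so they play the role of effective divisors on the affine line,
  and the recursion \<open>orbit_recursion\<close> is the logarithmic derivative of their L-series.\<close>

locale frobenius_character =
  fixes Q h :: nat and \<psi> :: "'b::alg_closed_field \<Rightarrow> complex"
  assumes prime_char: "prime CHAR('b)"
    and Q_eq: "Q = CHAR('b) ^ h" and h_pos: "h > 0"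
    and psi_0: "\<psi> 0 = 1"
    and psi_add: "x ^ Q = x \<Longrightarrow> y ^ Q = y \<Longrightarrow> \<psi> (x + y) = \<psi> x * \<psi> y"
    and psi_nontrivial: "\<exists>c. c ^ Q = c \<and> \<psi> c \<noteq> 1"
begin

definition J where "J = {x :: 'b. x ^ Q = x}"

text \<open>Meant for \<open>x ^ (Q ^ k) = x\<close>, where \<open>k\<close> may be any multiple of
  the least period e. Each point then occurs k / e times, and the polynomial with these roots is a
  power of the minimal polynomial of \<open>x\<close> over \<open>J\<close>.\<close>

definition orbit :: "nat \<Rightarrow> 'b \<Rightarrow> 'b multiset" where
  "orbit k x = image_mset (\<lambda>i. x ^ (Q ^ i)) (mset_set {..<k})"

definition stable :: "nat \<Rightarrow> 'b \<Rightarrow> 'b multiset set" where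
  "stable n t = {D. size D = n \<and> image_mset (\<lambda>x. x ^ Q) D = D \<and> prod_mset D = t}"

text \<open>The coefficient of degree \<open>n\<close>, at the group element \<open>t\<close>, of
  the L-series with values in the group algebra.\<close>

definition stable_sum :: "nat \<Rightarrow> 'b \<Rightarrow> complex" where
  "stable_sum n t = (\<Sum>D\<in>stable n t. \<psi> (sum_mset D))"

text \<open>The index set is the norm fibre over \<open>t\<close> in the field with
  \<open>Q ^ k\<close> elements, and \<open>\<psi>\<close> is applied to the relative trace: one
  side of the Davenport-Hasse relation.\<close>

definition orbit_sum :: "nat \<Rightarrow> 'b \<Rightarrow> complex" where
  "orbit_sum k t = (\<Sum>x | x ^ (Q ^ k) = x \<and> (\<Prod>i<k. x ^ (Q ^ i)) = t. \<psi> (\<Sum>i<k. x ^ (Q ^ i)))"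

lemma Q_gt_1: "Q > 1"
  unfolding Q_eq using prime_gt_1_nat[OF prime_char] h_pos by (intro one_less_power)

lemma frob_add: "(x + y :: 'b) ^ Q = x ^ Q + y ^ Q"
  by (rule freshmans_dream'[OF prime_char Q_eq])

lemma frob_sum: "(\<Sum>i\<in>A. f i :: 'b) ^ Q = (\<Sum>i\<in>A. f i ^ Q)"
  by (rule freshmans_dream_sum'[OF prime_char Q_eq])

lemma frob_uminus: "(- x :: 'b) ^ Q = - (x ^ Q)"
proof -
  have "(- x + x) ^ Q = (- x) ^ Q + x ^ Q" by (rule frob_add)
  then show ?thesis using Q_gt_1 by (simp add: eq_neg_iff_add_eq_0 power_0_left)
qed

lemma frob_inj: "(x :: 'b) ^ Q = y ^ Q \<longleftrightarrow> x = y"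
  using power_CHAR_power_inj[OF prime_char, of x h y] Q_eq by auto

lemma frob_iter_inj: "(x :: 'b) ^ (Q ^ i) = y ^ (Q ^ i) \<longleftrightarrow> x = y"
  using power_CHAR_power_inj[OF prime_char, of x "h * i" y] Q_eq by (auto simp: power_mult)

lemma frob_sum_mset: "(sum_mset D :: 'b) ^ Q = sum_mset (image_mset (\<lambda>x. x ^ Q) D)"
  using Q_gt_1 by (induction D) (auto simp: frob_add)

lemma frob_prod_mset: "(prod_mset D :: 'b) ^ Q = prod_mset (image_mset (\<lambda>x. x ^ Q) D)"
  by (induction D) (auto simp: power_mult_distrib)

lemma finite_frob_iter_fixed: "k > 0 \<Longrightarrow> finite {x :: 'b. x ^ (Q ^ k) = x}"
  using Q_gt_1 by (intro finite_power_fixed one_less_power) auto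

lemma finite_J [simp]: "finite J"
  unfolding J_def by (rule finite_power_fixed(1)[OF Q_gt_1])

sublocale G: finite_mult_group "J - {0}"
proof
  show "finite (J - {0})" by simp
qed (use Q_gt_1 in \<open>auto simp: J_def power_mult_distrib power_inverse\<close>)

lemma prod_orbit: "prod_mset (orbit k x) = (\<Prod>i<k. x ^ (Q ^ i))"
  by (simp add: orbit_def prod_unfold_prod_mset)

lemma sum_orbit: "sum_mset (orbit k x) = (\<Sum>i<k. x ^ (Q ^ i))"
  by (simp add: orbit_def sum_unfold_sum_mset)

lemma size_orbit [simp]: "size (orbit k x) = k"
  by (simp add: orbit_def)

lemma orbit_Suc: "orbit (Suc k) x = add_mset (x ^ (Q ^ k)) (orbit k x)"
  by (simp add: orbit_def lessThan_Suc)

section \<open>Frobenius orbits contained in a stable multiset\<close>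

lemma frob_orbit:
  assumes "x ^ (Q ^ k) = x"
  shows "image_mset (\<lambda>x. x ^ Q) (orbit k x) = orbit k x"
proof -
  \<comment> \<open>Before periodicity is used, the shift exchanges the first point \<open>x\<close>
    for \<open>x ^ (Q ^ k)\<close>.\<close>
  have "add_mset x (image_mset (\<lambda>x. x ^ Q) (orbit k x)) = add_mset (x ^ (Q ^ k)) (orbit k x)"
  proof (induction k)
    case (Suc k)
    then show ?case
      by (simp add: orbit_Suc add_mset_commute[of x] power_mult[symmetric] mult.commute)
  qed (simp add: orbit_def)
  then show ?thesis using assms by simp
qed

lemma orbit_add: "orbit (e + k) x = orbit e x + orbit k (x ^ (Q ^ e))"
  by (induction k) (auto simp: orbit_Suc power_add power_mult orbit_def[of 0])

lemma orbit_mult: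
  assumes "x ^ (Q ^ e) = x" shows "orbit (e * j) x = repeat_mset j (orbit e x)"
  by (induction j) (auto simp: orbit_add assms orbit_def[of 0])

lemma count_stable:
  fixes D :: "'b multiset"
  assumes "image_mset (\<lambda>x. x ^ Q) D = D" shows "count D (x ^ (Q ^ i)) = count D x"
proof (induction i)
  case (Suc i)
  have "count D ((x ^ (Q ^ i)) ^ Q) = count (image_mset (\<lambda>x. x ^ Q) D) ((x ^ (Q ^ i)) ^ Q)"
    by (simp only: assms)
  also have "\<dots> = count D (x ^ (Q ^ i))"
    by (cases "x ^ (Q ^ i) \<in># D") (auto simp: count_image_mset' frob_inj not_in_iff Collect_conv_if2
        intro!: sum.neutral)
  finally show ?case using Suc by (simp add: power_mult[symmetric] mult.commute)
qed simp

text \<open>The periods of \<open>x\<close> are the multiples of the least one, e, and the orbit of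
  length \<open>e * j\<close> is \<open>j\<close> copies of e distinct points. \<open>D\<close> has
  the same multiplicity at all of them, so this orbit fits into \<open>D\<close> exactly when
  \<open>j\<close> is at most \<open>count D x\<close>.\<close>

lemma card_orbits_through:
  assumes D: "image_mset (\<lambda>x. x ^ Q) D = D" and x: "x \<in># D"
  shows "card {k. k > 0 \<and> x ^ (Q ^ k) = x \<and> orbit k x \<subseteq># D} = count D x"
proof -
  have mem: "x ^ (Q ^ i) \<in># D" for i
    using count_stable[OF D] x by (metis count_eq_zero_iff)
  have "\<not> inj (\<lambda>i. x ^ (Q ^ i))"
  proof
    assume "inj (\<lambda>i. x ^ (Q ^ i))"
    then have "infinite (range (\<lambda>i. x ^ (Q ^ i)))" by (rule range_inj_infinite)
    moreover have "range (\<lambda>i. x ^ (Q ^ i)) \<subseteq> set_mset D" using mem by auto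
    ultimately show False using finite_subset by blast
  qed
  then obtain i j where ij: "i < j" "x ^ (Q ^ i) = x ^ (Q ^ j)"
    unfolding inj_def by (metis nat_neq_iff)
  have cancel: "x ^ (Q ^ (j - i)) = x" if "i < j" "x ^ (Q ^ i) = x ^ (Q ^ j)" for i j
  proof -
    have "(x ^ (Q ^ (j - i))) ^ (Q ^ i) = x ^ (Q ^ i)"
      using that by (simp add: power_mult[symmetric] power_add[symmetric])
    then show ?thesis by (simp only: frob_iter_inj)
  qed
  define e where "e = (LEAST k. k > 0 \<and> x ^ (Q ^ k) = x)"
  have ex: "\<exists>k. k > 0 \<and> x ^ (Q ^ k) = x" using cancel[OF ij] ij(1) by (intro exI[of _ "j - i"]) auto
  have e: "e > 0" "x ^ (Q ^ e) = x" using LeastI_ex[OF ex] unfolding e_def by auto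
  have least: "\<not> (k > 0 \<and> x ^ (Q ^ k) = x)" if "k < e" for k
    using not_less_Least that unfolding e_def by blast
  have inj: "inj_on (\<lambda>i. x ^ (Q ^ i)) {..<e}"
  proof (rule linorder_inj_onI)
    fix i j assume "i < j" "i \<in> {..<e}" "j \<in> {..<e}"
    then show "x ^ (Q ^ i) \<noteq> x ^ (Q ^ j)"
      using cancel[of i j] least[of "j - i"] by auto
  qed auto
  have orb: "orbit e x = mset_set ((\<lambda>i. x ^ (Q ^ i)) ` {..<e})"
    unfolding orbit_def using inj by (simp add: image_mset_mset_set)
  have fixed: "x ^ (Q ^ (e * j)) = x" for j
    by (induction j) (auto simp: power_add power_mult[of x] e(2))
  have dvd: "e dvd k" if "x ^ (Q ^ k) = x" for k
  proof -
    have "x ^ (Q ^ (e * (k div e) + k mod e)) = x ^ (Q ^ (k mod e))"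
      using fixed[of "k div e"] by (simp only: power_add power_mult[of x])
    then have "x ^ (Q ^ (k mod e)) = x" using that by simp
    with least[of "k mod e"] e(1) have "k mod e = 0" by fastforce
    then show ?thesis by auto
  qed
  have sub: "orbit (e * j) x \<subseteq># D \<longleftrightarrow> j \<le> count D x" for j
  proof
    assume "orbit (e * j) x \<subseteq># D"
    then have "j * count (orbit e x) x \<le> count D x"
      unfolding orbit_mult[OF e(2)] by (metis count_repeat_mset mset_subset_eq_count)
    moreover have "x \<in> (\<lambda>i. x ^ (Q ^ i)) ` {..<e}"
      using e(1) by (intro image_eqI[of _ _ 0]) auto
    then have "count (orbit e x) x = 1" unfolding orb by simp
    ultimately show "j \<le> count D x" by simp
  next
    assume j: "j \<le> count D x"
    show "orbit (e * j) x \<subseteq># D"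
      unfolding orbit_mult[OF e(2)] orb
    proof (rule mset_subset_eqI)
      fix y
      show "count (repeat_mset j (mset_set ((\<lambda>i. x ^ (Q ^ i)) ` {..<e}))) y \<le> count D y"
        using j count_stable[OF D] by (cases "y \<in> (\<lambda>i. x ^ (Q ^ i)) ` {..<e}") auto
    qed
  qed
  have "{k. k > 0 \<and> x ^ (Q ^ k) = x \<and> orbit k x \<subseteq># D} = (\<lambda>j. e * j) ` {1..count D x}"
  proof (intro equalityI subsetI)
    fix k assume k: "k \<in> {k. k > 0 \<and> x ^ (Q ^ k) = x \<and> orbit k x \<subseteq># D}"
    then obtain j where "k = e * j" using dvd by blast
    with k sub e(1) show "k \<in> (\<lambda>j. e * j) ` {1..count D x}" by auto
  qed (use sub e(1) fixed in auto)
  moreover have "inj_on (\<lambda>j. e * j) {1..count D x}" using e(1) by (auto simp: inj_on_def)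
  ultimately show ?thesis by (simp add: card_image)
qed

text \<open>The analogue of summing the von Mangoldt function over the divisors of a polynomial,
  which gives its degree: a pair stands for a root x of a prime power of degree k that divides the
  polynomial with root multiset \<open>D\<close>.\<close>

lemma card_orbits_below:
  assumes D: "image_mset (\<lambda>x. x ^ Q) D = D"
  defines "P \<equiv> {(k, x). k > 0 \<and> x ^ (Q ^ k) = x \<and> orbit k x \<subseteq># D}"
  shows "finite P" "card P = size D"
proof -
  have mem: "x \<in># D" if "k > 0" "orbit k x \<subseteq># D" for k x
  proof -
    have "x \<in># orbit k x" using that(1) by (auto simp: orbit_def intro!: image_eqI[of _ _ 0])
    then show ?thesis using that(2) mset_subset_eqD by metis
  qed
  have le: "k \<le> size D" if "orbit k x \<subseteq># D" for k x
    using size_mset_mono[OF that] by simp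
  let ?N = "\<lambda>x. {k. k > 0 \<and> x ^ (Q ^ k) = x \<and> orbit k x \<subseteq># D}"
  have fin: "finite (?N x)" for x
    by (rule finite_subset[of _ "{..size D}"]) (use le in auto)
  have eq: "P = prod.swap ` (SIGMA x:set_mset D. ?N x)"
    unfolding P_def using mem by (fastforce simp: image_iff)
  show "finite P" unfolding eq using fin by auto
  have "card P = card (SIGMA x:set_mset D. ?N x)"
    unfolding eq by (intro card_image) (auto simp: inj_on_def)
  also have "\<dots> = (\<Sum>x\<in>set_mset D. card (?N x))"
    using fin by (intro card_SigmaI) auto
  also have "\<dots> = (\<Sum>x\<in>set_mset D. count D x)"
    by (intro sum.cong refl card_orbits_through[OF D])
  also have "\<dots> = size D" by (simp add: size_multiset_overloaded_eq)
  finally show "card P = size D" .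
qed

section \<open>Stable multisets as monic polynomials over \<open>J\<close>\<close>

definition monics :: "nat \<Rightarrow> 'b \<Rightarrow> 'b poly set" where
  "monics n t = {f. Polynomial.degree f = n \<and> lead_coeff f = 1 \<and>
     (\<forall>i. Polynomial.coeff f i \<in> J) \<and> Polynomial.coeff f 0 = (- 1) ^ n * t}"

lemma frob_linear_prod:
  fixes D :: "'b multiset"
  shows "map_poly (\<lambda>x. x ^ Q) (linear_prod D) = linear_prod (image_mset (\<lambda>x. x ^ Q) D)"
proof (induction D)
  case empty
  then show ?case using Q_gt_1 by (simp add: map_poly_1)
next
  case (add x D)
  have mult: "map_poly (\<lambda>x. x ^ Q) (p * q) = map_poly (\<lambda>x. x ^ Q) p * map_poly (\<lambda>x. x ^ Q) q"
    for p q :: "'b poly"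
    using Q_gt_1
    by (intro poly_eqI) (simp add: coeff_map_poly coeff_mult frob_sum power_mult_distrib)
  have "map_poly (\<lambda>x. x ^ Q) [:- x, 1:] = [:- (x ^ Q), 1:]"
    using Q_gt_1 by (simp add: map_poly_pCons frob_uminus)
  then show ?case using add by (simp only: linear_prod_add mult image_mset_add_mset)
qed

text \<open>A split monic polynomial and its root multiset determine each other, so Frobenius fixes
  the coefficients if and only if it fixes the multiset. Algebraic closedness supplies the
  splitting.\<close>

lemma bij_betw_linear_prod: "bij_betw linear_prod (stable n t) (monics n t)"
proof (rule bij_betwI[where g = proots])
  have frob_iff: "(\<forall>i. Polynomial.coeff (linear_prod D) i \<in> J)
      \<longleftrightarrow> map_poly (\<lambda>x. x ^ Q) (linear_prod D) = linear_prod D" for D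
    unfolding poly_eq_iff J_def using Q_gt_1 by (auto simp: coeff_map_poly)
  have frob_iff': "(\<forall>i. Polynomial.coeff (linear_prod D) i \<in> J)
      \<longleftrightarrow> image_mset (\<lambda>x. x ^ Q) D = D" for D
    unfolding frob_iff frob_linear_prod by (metis proots_linear_prod)
  show "linear_prod \<in> stable n t \<rightarrow> monics n t"
    using frob_iff' lead_coeff_linear_prod by (auto simp: stable_def monics_def coeff_0_linear_prod)
  have split: "linear_prod (proots f) = f" if "f \<in> monics n t" for f
  proof -
    from that have lc: "lead_coeff f = 1" and nz: "f \<noteq> 0" by (auto simp: monics_def)
    from alg_closed_imp_factorization[OF nz] lc obtain A where "f = linear_prod A"
      by (auto simp: linear_prod_def)
    then show ?thesis by simp
  qed
  show "proots \<in> monics n t \<rightarrow> stable n t"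
  proof
    fix f assume f: "f \<in> monics n t"
    define D where "D = proots f"
    have fD: "f = linear_prod D" using split[OF f] D_def by simp
    show "proots f \<in> stable n t"
      using f frob_iff'[of D] unfolding fD monics_def stable_def
      by (auto simp: coeff_0_linear_prod)
  qed
  show "proots (linear_prod D) = D" if "D \<in> stable n t" for D by simp
  show "linear_prod (proots f) = f" if "f \<in> monics n t" for f using split that .
qed

lemma finite_monics: "finite (monics n t)"
proof (rule finite_subset)
  show "finite (Poly ` {xs. set xs \<subseteq> J \<and> length xs \<le> Suc n})"
    by (intro finite_imageI finite_lists_length_le finite_J)
  show "monics n t \<subseteq> Poly ` {xs. set xs \<subseteq> J \<and> length xs \<le> Suc n}"
  proof
    fix f assume f: "f \<in> monics n t"
    have "set (Polynomial.coeffs f) \<subseteq> J"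
      using f by (auto simp: monics_def coeffs_def simp del: upt_Suc)
    moreover have "length (Polynomial.coeffs f) \<le> Suc n"
      using f by (cases "f = 0") (auto simp: monics_def length_coeffs_degree)
    ultimately show "f \<in> Poly ` {xs. set xs \<subseteq> J \<and> length xs \<le> Suc n}"
      by (intro image_eqI[of _ _ "Polynomial.coeffs f"]) auto
  qed
qed

lemma finite_stable: "finite (stable n t)"
  using bij_betw_finite[OF bij_betw_linear_prod] finite_monics by blast

lemma stable_sum_0: "stable_sum 0 t = (if t = 1 then 1 else 0)"
proof -
  have "stable 0 t = (if t = 1 then {{#}} else {})" by (auto simp: stable_def)
  then show ?thesis by (simp add: stable_sum_def psi_0)
qed

lemma stable_sum_1:
  assumes "t \<in> J" shows "stable_sum 1 t = \<psi> t"
proof -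
  have "stable 1 t = {{#t#}}"
  proof (intro equalityI subsetI)
    fix D assume D: "D \<in> stable 1 t"
    then obtain a where "D = {#a#}" using size_1_singleton_mset by (auto simp: stable_def)
    with D show "D \<in> {{#t#}}" by (simp add: stable_def)
  qed (use assms in \<open>auto simp: stable_def J_def\<close>)
  then show ?thesis by (simp add: stable_sum_def)
qed

text \<open>Shifting the coefficient of degree \<open>n - 1\<close> multiplies the sum by a nontrivial value
  of the character.\<close>

lemma stable_sum_eq_0:
  assumes "n \<ge> 2" shows "stable_sum n t = 0"
proof -
  let ?S = "\<Sum>f\<in>monics n t. \<psi> (- Polynomial.coeff f (n - 1))"
  have "stable_sum n t = (\<Sum>D\<in>stable n t. \<psi> (- Polynomial.coeff (linear_prod D) (n - 1)))"
    unfolding stable_sum_def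
  proof (rule sum.cong[OF refl])
    fix D assume "D \<in> stable n t"
    then have "size D = n" by (simp add: stable_def)
    with assms have "Polynomial.coeff (linear_prod D) (n - 1) = - sum_mset D"
      using coeff_penultimate_linear_prod[of D] by fastforce
    then show "\<psi> (sum_mset D) = \<psi> (- Polynomial.coeff (linear_prod D) (n - 1))" by simp
  qed
  also have "\<dots> = ?S" by (rule sum.reindex_bij_betw[OF bij_betw_linear_prod])
  finally have S: "stable_sum n t = ?S" .
  obtain c where c: "c ^ Q = c" "\<psi> c \<noteq> 1" using psi_nontrivial by blast
  \<comment> \<open>By \<open>n \<ge> 2\<close> the index \<open>n - 1\<close> is positive, so the
    constant coefficient, which carries \<open>t\<close>, stays as it is.\<close>
  have shift: "f + Polynomial.monom a (n - 1) \<in> monics n t"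
    if f: "f \<in> monics n t" and a: "a ^ Q = a" for f a
  proof -
    have "Polynomial.degree (Polynomial.monom a (n - 1)) < n"
      using assms degree_monom_le[of a "n - 1"] by linarith
    then have d: "Polynomial.degree (f + Polynomial.monom a (n - 1)) = n"
      using f by (simp add: degree_add_eq_left monics_def)
    show ?thesis using f a assms
      Q_gt_1 unfolding monics_def mem_Collect_eq d by (auto simp: J_def frob_add)
  qed
  have neg: "(- c) ^ Q = - c" using c(1) by (simp add: frob_uminus)
  have "?S = (\<Sum>f\<in>monics n t. \<psi> (- Polynomial.coeff (f + Polynomial.monom (- c) (n - 1)) (n - 1)))"
    by (rule sum.reindex_bij_witness[where i = "\<lambda>f. f + Polynomial.monom (- c) (n - 1)"
          and j = "\<lambda>f. f + Polynomial.monom c (n - 1)"])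
       (use shift c(1) neg in \<open>auto simp: add.assoc add_monom\<close>)
  also have "\<dots> = (\<Sum>f\<in>monics n t. \<psi> c * \<psi> (- Polynomial.coeff f (n - 1)))"
  proof (rule sum.cong[OF refl])
    fix f assume f: "f \<in> monics n t"
    have "(- Polynomial.coeff f (n - 1)) ^ Q = - Polynomial.coeff f (n - 1)"
      using f by (simp add: monics_def J_def frob_uminus)
    then have "\<psi> (c + - Polynomial.coeff f (n - 1)) = \<psi> c * \<psi> (- Polynomial.coeff f (n - 1))"
      using c(1) by (rule psi_add[rotated])
    then show "\<psi> (- Polynomial.coeff (f + Polynomial.monom (- c) (n - 1)) (n - 1))
      = \<psi> c * \<psi> (- Polynomial.coeff f (n - 1))" by simp
  qed
  also have "\<dots> = \<psi> c * ?S" by (simp add: sum_distrib_left)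
  finally have "(\<psi> c - 1) * ?S = 0" by (simp add: algebra_simps)
  then show ?thesis using c(2) S by simp
qed

text \<open>Double count of pairs of a stable \<open>D\<close> and an orbit inside it. By
  \<open>card_orbits_below\<close> each \<open>D\<close> occurs \<open>n\<close> times. Removing the
  orbit splits \<open>D\<close> into two stable parts, along which sizes add and products and values
  of \<open>\<psi>\<close> multiply.\<close>

lemma orbit_recursion:
  assumes t: "t \<in> J - {0}"
  shows "of_nat n * stable_sum n t =
    (\<Sum>k=1..n. conv (J - {0}) (orbit_sum k) (stable_sum (n - k)) t)"
proof -
  define A where "A = (\<lambda>k s. {x :: 'b. x ^ (Q ^ k) = x \<and> (\<Prod>i<k. x ^ (Q ^ i)) = s})"
  define P where "P = (\<lambda>D. {(k, x). k > 0 \<and> x ^ (Q ^ k) = x \<and> orbit k x \<subseteq># D})"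
  have finA: "finite (A k s)" if "k > 0" for k s
    using finite_frob_iter_fixed[OF that] by (rule finite_subset[rotated]) (auto simp: A_def)
  have P: "finite (P D)" "card (P D) = n" if "D \<in> stable n t" for D
    using that card_orbits_below[of D] unfolding P_def by (auto simp: stable_def)
  let ?X = "SIGMA k:{1..n}. SIGMA s:J - {0}. A k s \<times> stable (n - k) (t / s)"
  have psi: "\<psi> (\<Sum>i<k. x ^ (Q ^ i)) * \<psi> (sum_mset E) = \<psi> (sum_mset (E + orbit k x))"
    if "x \<in> A k s" "E \<in> stable m u" for k x s E m u
  proof -
    have "sum_mset (orbit k x) ^ Q = sum_mset (orbit k x)"
      using that(1) by (simp add: frob_sum_mset frob_orbit A_def)
    moreover have "sum_mset E ^ Q = sum_mset E"
      using that(2) by (simp add: frob_sum_mset stable_def)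
    ultimately show ?thesis by (simp add: psi_add sum_orbit)
  qed
  have os: "orbit_sum k s = (\<Sum>x\<in>A k s. \<psi> (\<Sum>i<k. x ^ (Q ^ i)))" for k s
    by (simp add: orbit_sum_def A_def)
  have "(\<Sum>k=1..n. conv (J - {0}) (orbit_sum k) (stable_sum (n - k)) t)
     = (\<Sum>k=1..n. \<Sum>s\<in>J - {0}. \<Sum>(x, E)\<in>A k s \<times> stable (n - k) (t / s).
          \<psi> (sum_mset (E + orbit k x)))"
  proof (rule sum.cong[OF refl], unfold conv_def, rule sum.cong[OF refl])
    fix k s
    show "orbit_sum k s * stable_sum (n - k) (t / s)
        = (\<Sum>(x, E)\<in>A k s \<times> stable (n - k) (t / s). \<psi> (sum_mset (E + orbit k x)))"
      unfolding os stable_sum_def sum_product sum.cartesian_product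
      by (rule sum.cong[OF refl]) (auto simp: psi simp del: sum_mset.union)
  qed
  also have "\<dots> = (\<Sum>k=1..n. \<Sum>(s, x, E)\<in>(SIGMA s:J - {0}. A k s \<times> stable (n - k) (t / s)).
          \<psi> (sum_mset (E + orbit k x)))"
    using finA finite_stable by (intro sum.cong refl sum.Sigma) auto
  also have "\<dots> = (\<Sum>(k, s, x, E)\<in>?X. \<psi> (sum_mset (E + orbit k x)))"
    using finA finite_stable by (intro sum.Sigma) auto
  also have "\<dots> = (\<Sum>(D, k, x)\<in>(SIGMA D:stable n t. P D). \<psi> (sum_mset D))"
  proof (rule sum.reindex_bij_witness[where
        i = "\<lambda>(D, k, x). (k, \<Prod>i<k. x ^ (Q ^ i), x, D - orbit k x)" and
        j = "\<lambda>(k, s, x, E). (E + orbit k x, k, x)"], goal_cases)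
    case (1 a)
    then show ?case by (auto simp: A_def)
  next
    case (2 a)
    obtain k s x E where a: "a = (k, s, x, E)" by (cases a)
    from 2 have k: "k \<in> {1..n}" and s: "s \<noteq> 0" and x: "x \<in> A k s"
      and E: "E \<in> stable (n - k) (t / s)" unfolding a by auto
    have "prod_mset (E + orbit k x) = t"
      using x E s by (simp add: prod_orbit stable_def A_def)
    moreover have "image_mset (\<lambda>x. x ^ Q) (E + orbit k x) = E + orbit k x"
      using x E frob_orbit[of x k] by (simp add: stable_def A_def)
    moreover have "size (E + orbit k x) = n" using k E by (simp add: stable_def)
    ultimately show ?case
      using k x unfolding a by (simp add: stable_def P_def A_def)
  next
    case (3 b)
    then show ?case by (auto simp: P_def)
  next
    case (4 b)
    then obtain D k x where b: "b = (D, k, x)" and D: "size D = n"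
      "image_mset (\<lambda>x. x ^ Q) D = D" "prod_mset D = t"
      and x: "k > 0" "x ^ (Q ^ k) = x" "orbit k x \<subseteq># D"
      by (auto simp: stable_def P_def)
    define E where "E = D - orbit k x"
    have DE: "D = E + orbit k x" using x(3) by (simp add: E_def)
    have E: "image_mset (\<lambda>x. x ^ Q) E = E"
      using D(2) frob_orbit[OF x(2)] unfolding DE by simp
    have prod: "prod_mset E * prod_mset (orbit k x) = t" using D(3) by (simp add: DE)
    \<comment> \<open>\<open>t \<noteq> 0\<close> makes the product over the orbit nonzero, so the
      rest of \<open>D\<close> lies over a quotient in the group.\<close>
    with t have "prod_mset (orbit k x) \<in> J - {0}"
      by (auto simp: J_def frob_prod_mset frob_orbit[OF x(2)])
    moreover have "k \<le> n" "size E = n - k" using D(1) unfolding DE by auto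
    moreover have "E \<in> stable (n - k) (t / prod_mset (orbit k x))"
      using calculation prod E by (simp add: stable_def nonzero_eq_divide_eq)
    ultimately show ?case using x(1,2) unfolding b
      by (simp add: A_def prod_orbit E_def[symmetric])
  next
    case (5 a)
    then show ?case by auto
  qed
  also have "\<dots> = (\<Sum>D\<in>stable n t. \<Sum>(k, x)\<in>P D. \<psi> (sum_mset D))"
    using P finite_stable by (subst sum.Sigma) auto
  also have "\<dots> = (\<Sum>D\<in>stable n t. of_nat n * \<psi> (sum_mset D))"
    using P by (intro sum.cong refl) (simp add: case_prod_unfold)
  finally show ?thesis by (simp add: stable_sum_def sum_distrib_left)
qed

text \<open>Its coefficients vanish from degree 2 on, so the L-series is 1 + \<open>\<psi>\<close>
  X. Only two terms of the recursion survive, and each orbit sum is minus the convolution of the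
  preceding one with \<open>\<psi>\<close>.\<close>

theorem orbit_sum_eq_conv_pow:
  assumes "t \<in> J - {0}"
  shows "orbit_sum (Suc k) t = (- 1) ^ k * conv_pow (J - {0}) \<psi> (Suc k) t"
  using assms
proof (induction k arbitrary: t)
  case 0
  have "{x. x ^ Q = x \<and> x = t} = {t}" using 0 by (auto simp: J_def)
  then have "orbit_sum (Suc 0) t = \<psi> t" by (simp add: orbit_sum_def)
  then show ?case using G.conv_delta_right[OF 0, of \<psi>] by simp
next
  case (Suc k)
  let ?G = "J - {0}" and ?n = "Suc (Suc k)"
  have "conv ?G (orbit_sum j) (stable_sum (?n - j)) t = 0" if "1 \<le> j" "j \<le> k" for j
    unfolding conv_def using that by (intro sum.neutral ballI) (simp add: stable_sum_eq_0)
  then have "0 = conv ?G (orbit_sum (Suc k)) (stable_sum 1) t + conv ?G (orbit_sum ?n) (stable_sum 0) t"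
    using orbit_recursion[OF Suc.prems, of ?n] stable_sum_eq_0[of ?n t] by simp
  also have "conv ?G (orbit_sum ?n) (stable_sum 0) t = orbit_sum ?n t"
    unfolding stable_sum_0[abs_def] by (rule G.conv_delta_right[OF Suc.prems])
  also have "conv ?G (orbit_sum (Suc k)) (stable_sum 1) t
      = conv ?G (\<lambda>t. (- 1) ^ k * conv_pow ?G \<psi> (Suc k) t) \<psi> t"
    using Suc by (intro G.conv_cong) (auto simp: stable_sum_1[unfolded One_nat_def])
  also have "\<dots> = (- 1) ^ k * conv ?G (conv_pow ?G \<psi> (Suc k)) \<psi> t"
    by (simp add: conv_def sum_distrib_left mult_ac)
  also have "conv ?G (conv_pow ?G \<psi> (Suc k)) \<psi> t = conv_pow ?G \<psi> ?n t"
    using G.conv_commute[OF Suc.prems] by simp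
  finally show ?case by (simp add: add_eq_0_iff)
qed

end

section \<open>Subfields and additive characters\<close>

lemma prime_CHAR_finite: "prime CHAR('a::{finite,field})"
  by (intro prime_CHAR_semidom finite_imp_CHAR_pos) simp

lemma subfield_UNIV: "Defs.subfield UNIV"
  by (simp add: Defs.subfield_def)

lemma subfieldD:
  assumes "Defs.subfield F"
  shows "0 \<in> F" "1 \<in> F" "x \<in> F \<Longrightarrow> y \<in> F \<Longrightarrow> x + y \<in> F"
    "x \<in> F \<Longrightarrow> y \<in> F \<Longrightarrow> x * y \<in> F" "x \<in> F \<Longrightarrow> - x \<in> F" "x \<in> F \<Longrightarrow> inverse x \<in> F"
  using assms by (auto simp: Defs.subfield_def)

text \<open>The sum of \<open>W\<close> and \<open>S v\<close> is direct: a nontrivial relation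
  could be divided by a scalar of \<open>S\<close> and solved for \<open>v\<close>.\<close>

lemma card_subspace_insert:
  fixes S W :: "'a::{finite,field} set"
  assumes S: "Defs.subfield S"
    and W: "\<And>x y. x \<in> W \<Longrightarrow> y \<in> W \<Longrightarrow> x + y \<in> W"
      "\<And>s x. s \<in> S \<Longrightarrow> x \<in> W \<Longrightarrow> s * x \<in> W"
    and v: "v \<notin> W"
  shows "card ((\<lambda>(w, s). w + s * v) ` (W \<times> S)) = card W * card S"
proof -
  note S = subfieldD[OF S]
  have "inj_on (\<lambda>(w, s). w + s * v) (W \<times> S)"
  proof (clarsimp simp: inj_on_def)
    fix w s w' s' assume ws: "w \<in> W" "s \<in> S" "w' \<in> W" "s' \<in> S" and eq: "w + s * v = w' + s' * v"
    have *: "(s - s') * v = w' - w" using eq by (simp add: algebra_simps)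
    have "s = s'"
    proof (rule ccontr)
      assume ne: "s \<noteq> s'"
      have "w' - w \<in> W" using W(1)[OF ws(3) W(2)[of "- 1" w]] S ws by simp
      moreover have "inverse (s - s') \<in> S" using S(3)[OF ws(2) S(5)[OF ws(4)]] S(6) by simp
      ultimately have "inverse (s - s') * (w' - w) \<in> W" by (rule W(2)[rotated])
      also have "inverse (s - s') * (w' - w) = v" using ne unfolding *[symmetric] by simp
      finally show False using v by simp
    qed
    with eq show "w = w' \<and> s = s'" by simp
  qed
  then show ?thesis by (simp add: card_image card_cartesian_product)
qed

text \<open>This replaces a choice of basis: among the subspaces of \<open>V\<close> of size |S|^m,
  one with maximal m is all of \<open>V\<close>, since otherwise another vector could be
  adjoined.\<close>

lemma card_subspace_power:
  fixes S V :: "'a::{finite,field} set"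
  assumes S: "Defs.subfield S" and V: "0 \<in> V" "\<And>x y. x \<in> V \<Longrightarrow> y \<in> V \<Longrightarrow> x + y \<in> V"
      "\<And>s x. s \<in> S \<Longrightarrow> x \<in> V \<Longrightarrow> s * x \<in> V"
  shows "\<exists>m. card V = card S ^ m"
proof -
  note SD = subfieldD[OF S]
  define good where "good = (\<lambda>W m. W \<subseteq> V \<and> (\<forall>x\<in>W. \<forall>y\<in>W. x + y \<in> W) \<and>
     (\<forall>s\<in>S. \<forall>x\<in>W. s * x \<in> W) \<and> card W = card S ^ m)"
  have S2: "card S \<ge> 2"
  proof -
    have "card {0, 1 :: 'a} \<le> card S" using SD by (intro card_mono) auto
    then show ?thesis by simp
  qed
  have ex: "\<exists>W. good W 0" using V by (intro exI[of _ "{0}"]) (auto simp: good_def)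
  have bound: "m \<le> card V" if "\<exists>W. good W m" for m
  proof -
    from that obtain W where "card S ^ m \<le> card V"
      unfolding good_def using card_mono[of V] by (metis finite)
    moreover have "m < card S ^ m" using S2 by (intro power_gt_expt) auto
    ultimately show ?thesis by simp
  qed
  obtain m where m: "\<exists>W. good W m" "\<And>k. \<exists>W. good W k \<Longrightarrow> k \<le> m"
    using Nat.ex_has_greatest_nat[of "\<lambda>m. \<exists>W. good W m" 0 "card V"] ex bound by auto
  then obtain W where gW: "good W m" by blast
  have W: "W \<subseteq> V" "\<And>x y. x \<in> W \<Longrightarrow> y \<in> W \<Longrightarrow> x + y \<in> W"
    "\<And>s x. s \<in> S \<Longrightarrow> x \<in> W \<Longrightarrow> s * x \<in> W" "card W = card S ^ m"
    using gW unfolding good_def by blast+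
  have "W = V"
  proof (rule ccontr)
    assume "W \<noteq> V"
    then obtain v where v: "v \<in> V" "v \<notin> W" using W(1) by blast
    let ?W = "(\<lambda>(w, s). w + s * v) ` (W \<times> S)"
    have "good ?W (Suc m)"
      unfolding good_def
    proof (intro conjI ballI)
      show "?W \<subseteq> V" using V W(1) v by auto
      show "card ?W = card S ^ Suc m"
        using card_subspace_insert[OF S W(2,3) v(2)] W(4) by simp
    next
      fix x y assume "x \<in> ?W" "y \<in> ?W"
      then obtain w s w' s' where "w \<in> W" "s \<in> S" "w' \<in> W" "s' \<in> S" "x = w + s * v" "y = w' + s' * v"
        by auto
      then show "x + y \<in> ?W"
        using W(2) SD(3) by (intro image_eqI[of _ _ "(w + w', s + s')"]) (auto simp: algebra_simps)
    next
      fix a x assume "a \<in> S" "x \<in> ?W"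
      then obtain w s where "w \<in> W" "s \<in> S" "x = w + s * v" "a \<in> S" by auto
      then show "a * x \<in> ?W"
        using W(3) SD(4) by (intro image_eqI[of _ _ "(a * w, a * s)"]) (auto simp: algebra_simps)
    qed
    with m(2)[of "Suc m"] show False by auto
  qed
  with W(4) show ?thesis by blast
qed

section \<open>The prime field and the orders of subfields\<close>

definition prime_field :: "'a::{finite,field} set" where
  "prime_field = of_nat ` {..<CHAR('a)}"

lemma inj_on_of_nat_CHAR: "inj_on (of_nat :: nat \<Rightarrow> 'a::{finite,field}) {..<CHAR('a)}"
  by (auto simp: inj_on_def of_nat_eq_iff_cong_CHAR cong_def)

lemma card_prime_field: "card (prime_field :: 'a::{finite,field} set) = CHAR('a)"
  unfolding prime_field_def using inj_on_of_nat_CHAR[where ?'a='a] by (simp add: card_image)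

lemma of_nat_in_prime_field: "of_nat k \<in> (prime_field :: 'a::{finite,field} set)"
proof -
  have "(of_nat k :: 'a) = of_nat (k mod CHAR('a))"
    by (simp add: of_nat_eq_iff_cong_CHAR)
  moreover have "k mod CHAR('a) < CHAR('a)"
    using prime_CHAR_finite[where ?'a='a] by (simp add: prime_gt_0_nat)
  ultimately show ?thesis by (auto simp: prime_field_def)
qed

lemma subfield_prime_field: "Defs.subfield (prime_field :: 'a::{finite,field} set)"
proof -
  let ?P = "prime_field :: 'a set" and ?p = "CHAR('a)"
  have p: "prime ?p" by (rule prime_CHAR_finite)
  have repr: "\<exists>k. x = of_nat k" if "x \<in> ?P" for x using that by (auto simp: prime_field_def)
  have add: "x + y \<in> ?P" "x * y \<in> ?P" if xy: "x \<in> ?P" "y \<in> ?P" for x y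
  proof -
    obtain k l where "x = of_nat k" "y = of_nat l" using repr xy by metis
    then show "x + y \<in> ?P" "x * y \<in> ?P"
      using of_nat_in_prime_field[of "k + l"] of_nat_in_prime_field[of "k * l"] by auto
  qed
  have m1: "- 1 \<in> ?P"
  proof -
    have "of_nat (?p - 1) + 1 = (of_nat (Suc (?p - 1)) :: 'a)" by simp
    also have "Suc (?p - 1) = ?p" using prime_gt_0_nat[OF p] by simp
    finally have "of_nat (?p - 1) + 1 = (0 :: 'a)" by simp
    then have "of_nat (?p - 1) = (- 1 :: 'a)" by (simp add: eq_neg_iff_add_eq_0)
    then show ?thesis using of_nat_in_prime_field by metis
  qed
  have inv: "inverse x \<in> ?P" if x: "x \<in> ?P" for x
  proof (cases "x = 0")
    case True
    then show ?thesis using x by simp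
  next
    case False
    obtain k where k: "x = of_nat k" using repr x by blast
    then have "\<not> ?p dvd k" using False by (simp add: of_nat_eq_0_iff_char_dvd)
    then have "coprime k ?p" using p by (metis prime_imp_coprime coprime_commute)
    then obtain l where "[k * l = 1] (mod ?p)" using cong_solve_coprime_nat by (metis One_nat_def)
    then have "of_nat (k * l) = (of_nat 1 :: 'a)" by (simp only: of_nat_eq_iff_cong_CHAR)
    then have "x * of_nat l = 1" using k by simp
    then have "inverse x = of_nat l" by (rule inverse_unique)
    then show ?thesis using of_nat_in_prime_field by simp
  qed
  have "- x \<in> ?P" if "x \<in> ?P" for x using add(2)[OF m1 that] by simp
  then show ?thesis
    using add inv of_nat_in_prime_field[of 0] of_nat_in_prime_field[of 1]
    by (simp add: Defs.subfield_def)
qed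

lemma subfield_of_nat:
  assumes "Defs.subfield F" shows "of_nat k \<in> F"
  using subfieldD[OF assms] by (induction k) auto

lemma card_subfield_ge_2:
  assumes "Defs.subfield (F :: 'a::{finite,field} set)" shows "card F \<ge> 2"
proof -
  have "card {0, 1 :: 'a} \<le> card F" using subfieldD[OF assms] by (intro card_mono) auto
  then show ?thesis by simp
qed

lemma card_subfield:
  assumes "Defs.subfield (F :: 'a::{finite,field} set)"
  shows "\<exists>h>0. card F = CHAR('a) ^ h"
proof -
  have "\<exists>h. card F = card (prime_field :: 'a set) ^ h"
    using subfieldD[OF assms] subfield_of_nat[OF assms]
    by (intro card_subspace_power subfield_prime_field) (auto simp: prime_field_def)
  then obtain h where h: "card F = CHAR('a) ^ h" by (auto simp: card_prime_field)
  with card_subfield_ge_2[OF assms] have "h > 0" by (cases h) auto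
  with h show ?thesis by blast
qed

lemma finite_mult_group_subfield:
  assumes "Defs.subfield (F :: 'a::{finite,field} set)" shows "finite_mult_group (F - {0})"
  using subfieldD[OF assms] by unfold_locales auto

lemma subfield_power_card:
  assumes F: "Defs.subfield (F :: 'a::{finite,field} set)" and x: "x \<in> F"
  shows "x ^ card F = x"
proof (cases "x = 0")
  case True
  then show ?thesis using card_subfield_ge_2[OF F] by simp
next
  case False
  interpret finite_mult_group "F - {0}" by (rule finite_mult_group_subfield[OF F])
  have "(\<Prod>y\<in>F - {0}. y) = (\<Prod>y\<in>F - {0}. x * y)"
    by (rule prod.reindex_bij_witness[where i = "\<lambda>y. x * y" and j = "\<lambda>y. y / x"])
       (use x False subfieldD[OF F] in \<open>auto simp: divide_inverse\<close>)
  also have "\<dots> = x ^ card (F - {0}) * (\<Prod>y\<in>F - {0}. y)"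
    by (simp add: prod.distrib)
  finally have "x ^ card (F - {0}) = 1" by simp
  moreover have "card F = Suc (card (F - {0}))"
    using subfieldD(1)[OF F] card_subfield_ge_2[OF F] by (simp add: card_Diff_singleton)
  ultimately show ?thesis by simp
qed

text \<open>\<open>F\<close> already provides as many roots of X^|F| - X as the degree allows.
  Membership in a subfield becomes a Frobenius equation.\<close>

lemma subfield_eq_fixed:
  assumes F: "Defs.subfield (F :: 'a::{finite,field} set)"
  shows "F = {x. x ^ card F = x}"
proof (rule card_subset_eq)
  have *: "card F > 1" using card_subfield_ge_2[OF F] by simp
  show sub: "F \<subseteq> {x. x ^ card F = x}" using subfield_power_card[OF F] by blast
  have "card F \<le> card {x :: 'a. x ^ card F = x}" using card_mono[OF _ sub] by simp
  then show "card F = card {x :: 'a. x ^ card F = x}"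
    using finite_power_fixed(2)[OF *, where ?'b='a] by linarith
qed simp

text \<open>The formula of \<open>psi\<close> with the trace taken out, so that the traces of all
  subfields can be inserted. Off the prime field the description is not satisfied by any
  \<open>k\<close>.\<close>

definition prime_char :: "'a::{finite,field} \<Rightarrow> complex" where
  "prime_char z = exp (2 * pi * \<i> * of_nat (THE k. k < CHAR('a) \<and> of_nat k = z) / of_nat CHAR('a))"

lemma prime_char_of_nat:
  "prime_char (of_nat k :: 'a::{finite,field}) = exp (2 * pi * \<i> * of_nat k / of_nat CHAR('a))"
proof -
  let ?p = "CHAR('a)"
  have p: "?p > 0" using prime_CHAR_finite[where ?'a='a] by (simp add: prime_gt_0_nat)
  have "(THE l. l < ?p \<and> of_nat l = (of_nat k :: 'a)) = k mod ?p"
    using p by (intro the_equality) (auto simp: of_nat_eq_iff_cong_CHAR cong_def)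
  then have "prime_char (of_nat k :: 'a) = exp (2 * pi * \<i> * of_nat (k mod ?p) / of_nat ?p)"
    by (simp add: prime_char_def)
  also have "\<dots> = exp (2 * pi * \<i> * of_nat k / of_nat ?p)"
  proof -
    have "complex_of_nat k = of_nat (k mod ?p + ?p * (k div ?p))" by simp
    also have "\<dots> = of_nat (k mod ?p) + of_nat ?p * of_nat (k div ?p)"
      by (simp only: of_nat_add of_nat_mult)
    finally have "2 * pi * \<i> * of_nat k / of_nat ?p
        = 2 * pi * \<i> * of_nat (k mod ?p) / of_nat ?p + complex_of_real (of_int (2 * int (k div ?p)) * pi) * \<i>"
      using p by (simp add: field_simps)
    then have "exp (2 * pi * \<i> * of_nat k / of_nat ?p) = exp (2 * pi * \<i> * of_nat (k mod ?p) / of_nat ?p)"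
      unfolding exp_eq by blast
    then show ?thesis by simp
  qed
  finally show ?thesis .
qed

lemma prime_char_0 [simp]: "prime_char (0 :: 'a::{finite,field}) = 1"
  using prime_char_of_nat[of 0, where ?'a='a] by simp

lemma prime_char_add:
  assumes "x \<in> prime_field" "y \<in> prime_field"
  shows "prime_char (x + y) = prime_char x * prime_char y"
proof -
  obtain k l where "x = of_nat k" "y = of_nat l" using assms by (auto simp: prime_field_def)
  then have "prime_char (x + y) = prime_char (of_nat (k + l) :: 'a)" by simp
  also have "\<dots> = prime_char (of_nat k :: 'a) * prime_char (of_nat l :: 'a)"
    unfolding prime_char_of_nat by (simp add: exp_add[symmetric] algebra_simps add_divide_distrib)
  finally show ?thesis using \<open>x = of_nat k\<close> \<open>y = of_nat l\<close> by simp
qed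

lemma prime_char_eq_1:
  assumes "x \<in> (prime_field :: 'a::{finite,field} set)" "prime_char x = 1" shows "x = 0"
proof -
  obtain k where k: "x = of_nat k" "k < CHAR('a)" using assms(1) by (auto simp: prime_field_def)
  have "exp (2 * pi * \<i> * of_nat k / of_nat CHAR('a)) = exp (0 :: complex)"
    using assms(2) k by (simp add: prime_char_of_nat)
  then obtain n :: int where "2 * pi * \<i> * of_nat k / of_nat CHAR('a) = 0 + (2 * of_int n * pi) * \<i>"
    unfolding exp_eq by auto
  then have "complex_of_real (real k) = of_real (real_of_int n * real CHAR('a))"
    using k(2) by (simp add: field_simps)
  then have "real k = real_of_int n * real CHAR('a)" by (simp only: of_real_eq_iff)
  then have "real_of_int (int k) = real_of_int (n * int CHAR('a))" by simp
  then have "int k = n * int CHAR('a)" by (simp only: of_int_eq_iff)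
  then have "CHAR('a) dvd k" by (metis dvd_triv_right of_nat_dvd_iff)
  then have "k = 0" using k(2) by (auto dest: dvd_imp_le)
  then show ?thesis using k by simp
qed

text \<open>\<open>h\<close> is the degree over the prime field of the subfield whose canonical
  character is meant; one function serves \<open>I\<close>, \<open>J\<close> and the whole
  field.\<close>

definition trace_char :: "nat \<Rightarrow> 'a::{finite,field} \<Rightarrow> complex" where
  "trace_char h x = prime_char (\<Sum>i<h. x ^ (CHAR('a) ^ i))"

locale finite_subfield =
  fixes F :: "'a::{finite,field} set" and h :: nat
  assumes subfield: "Defs.subfield F" and card_F: "card F = CHAR('a) ^ h"
begin

lemmas closed [simp] = subfieldD[OF subfield]

lemma diff_closed [simp]: "x \<in> F \<Longrightarrow> y \<in> F \<Longrightarrow> x - y \<in> F"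
  unfolding diff_conv_add_uminus by (intro closed)

lemma power_closed [simp]: "x \<in> F \<Longrightarrow> x ^ k \<in> F"
  by (induction k) auto

lemma h_pos: "h > 0"
  using card_subfield_ge_2[OF subfield] card_F by (cases h) auto

lemma F_eq: "F = {x. x ^ (CHAR('a) ^ h) = x}"
  using subfield_eq_fixed[OF subfield] unfolding card_F .

text \<open>Frobenius permutes the summands cyclically, and its fixed points form the prime
  field.\<close>

lemma trace_in_prime_field:
  assumes "x \<in> F" shows "(\<Sum>i<h. x ^ (CHAR('a) ^ i)) \<in> prime_field"
proof -
  let ?p = "CHAR('a)" and ?T = "\<Sum>i<h. x ^ (CHAR('a) ^ i)"
  have "?T ^ ?p = (\<Sum>i<h. x ^ (?p ^ Suc i))"
    using freshmans_dream_sum'[OF prime_CHAR_finite, of ?p 1 "\<lambda>i. x ^ (?p ^ i)" "{..<h}"]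
    by (simp add: power_mult[symmetric] mult.commute)
  also have "\<dots> + x = (\<Sum>i<Suc h. x ^ (?p ^ i))"
    by (simp only: sum.lessThan_Suc_shift power_0 power_one_right add.commute)
  also have "\<dots> = ?T + x" using assms F_eq by auto
  finally have "?T ^ ?p = ?T" by simp
  then show ?thesis
    using subfield_eq_fixed[OF subfield_prime_field, where ?'a='a] unfolding card_prime_field by auto
qed

lemma trace_char_0 [simp]: "trace_char h (0 :: 'a) = 1"
proof -
  have "(\<Sum>i<h. (0 :: 'a) ^ (CHAR('a) ^ i)) = 0"
    using prime_CHAR_finite[where ?'a='a] by (intro sum.neutral) (auto simp: prime_gt_0_nat)
  then show ?thesis by (simp add: trace_char_def)
qed

lemma trace_char_add:
  assumes "x \<in> F" "y \<in> F" shows "trace_char h (x + y) = trace_char h x * trace_char h y"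
proof -
  have "(\<Sum>i<h. (x + y) ^ (CHAR('a) ^ i)) = (\<Sum>i<h. x ^ (CHAR('a) ^ i)) + (\<Sum>i<h. y ^ (CHAR('a) ^ i))"
    by (simp add: sum.distrib[symmetric] freshmans_dream'[OF prime_CHAR_finite refl])
  then show ?thesis
    unfolding trace_char_def using assms by (simp add: prime_char_add trace_in_prime_field)
qed

text \<open>Otherwise the trace polynomial, of degree p^(h-1), would have all p^h elements of
  \<open>F\<close> as roots.\<close>

lemma trace_char_nontrivial: "\<exists>x\<in>F. trace_char h x \<noteq> 1"
proof (rule ccontr)
  let ?p = "CHAR('a)"
  have p: "?p > 1" using prime_CHAR_finite[where ?'a='a] by (rule prime_gt_1_nat)
  assume "\<not> ?thesis"
  then have zero: "(\<Sum>i<h. x ^ (?p ^ i)) = 0" if "x \<in> F" for x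
    using that prime_char_eq_1 trace_in_prime_field unfolding trace_char_def by blast
  let ?f = "\<Sum>i<h. Polynomial.monom 1 (?p ^ i) :: 'a poly"
  have "Polynomial.coeff ?f (?p ^ (h - 1)) = (\<Sum>i<h. if i = h - 1 then 1 else 0)"
    unfolding coeff_sum using p by (intro sum.cong) auto
  also have "\<dots> = 1" using h_pos by simp
  finally have nz: "?f \<noteq> 0" by (metis coeff_0 zero_neq_one)
  have deg: "Polynomial.degree ?f \<le> ?p ^ (h - 1)"
  proof (rule degree_sum_le)
    fix i assume "i \<in> {..<h}"
    then have "?p ^ i \<le> ?p ^ (h - 1)" using p by (intro power_increasing) auto
    then show "Polynomial.degree (Polynomial.monom 1 (?p ^ i) :: 'a poly) \<le> ?p ^ (h - 1)"
      using degree_monom_le le_trans by blast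
  qed simp
  have "F \<subseteq> {x. poly ?f x = 0}" using zero by (auto simp: poly_sum poly_monom)
  then have "card F \<le> card {x. poly ?f x = 0}" by (intro card_mono) auto
  also have "\<dots> \<le> ?p ^ (h - 1)" using card_poly_roots_bound[OF nz] deg by linarith
  also have "\<dots> < ?p ^ h" using p h_pos by (intro power_strict_increasing) auto
  finally show False using card_F by simp
qed

lemma sum_trace_char:
  assumes a: "a \<in> F" shows "(\<Sum>x\<in>F. trace_char h (a * x)) = (if a = 0 then of_nat (card F) else 0)"
proof (cases "a = 0")
  case False
  obtain c where c: "c \<in> F" "trace_char h c \<noteq> 1" using trace_char_nontrivial by blast
  let ?S = "\<Sum>x\<in>F. trace_char h (a * x)"
  have "?S = (\<Sum>x\<in>F. trace_char h (a * (x + c / a)))"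
    by (rule sum.reindex_bij_witness[where i = "\<lambda>x. x + c / a" and j = "\<lambda>x. x - c / a"])
       (use a c in \<open>auto simp: divide_inverse\<close>)
  also have "\<dots> = (\<Sum>x\<in>F. trace_char h c * trace_char h (a * x))"
    using False a c by (intro sum.cong) (auto simp: algebra_simps trace_char_add)
  finally have "(1 - trace_char h c) * ?S = 0" by (simp add: sum_distrib_left[symmetric] algebra_simps)
  then show ?thesis using c False by simp
qed simp

end

lemma psi_eq_trace_char:
  assumes "CARD('a::{finite,field}) = CHAR('a) ^ n"
  shows "psi (x :: 'a) = trace_char n x"
proof -
  have "CHAR('a) > 1" using prime_CHAR_finite[where ?'a='a] by (rule prime_gt_1_nat)
  then have "field_deg TYPE('a) = n"
    unfolding field_deg_def assms by (intro the_equality) auto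
  then show ?thesis by (simp add: psi_def trace_char_def prime_char_def abs_trace_def)
qed

text \<open>Transitivity of the trace: each index below \<open>h * m\<close> is uniquely of the form
  \<open>i + h * j\<close>.\<close>

lemma trace_char_mult:
  "trace_char (h * m) x = trace_char h (\<Sum>j<m. x ^ ((CHAR('a) ^ h) ^ j))" for x :: "'a::{finite,field}"
proof -
  let ?p = "CHAR('a)"
  have "(\<Sum>i<h. (\<Sum>j<m. x ^ ((?p ^ h) ^ j)) ^ (?p ^ i)) = (\<Sum>i<h. \<Sum>j<m. x ^ (?p ^ (i + h * j)))"
    by (simp add: freshmans_dream_sum'[OF prime_CHAR_finite refl] power_mult[symmetric] power_add mult.commute)
  also have "\<dots> = (\<Sum>j<m. \<Sum>i<h. x ^ (?p ^ (i + h * j)))" by (rule sum.swap)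
  also have "\<dots> = (\<Sum>i<h * m. x ^ (?p ^ i))"
  proof (induction m)
    case (Suc m)
    have add: "(\<Sum>i<a + b. f i) = (\<Sum>i<a. f i) + (\<Sum>i<b. f (i + a) :: 'a)" for a b :: nat and f
      by (induction b) (auto simp: algebra_simps)
    have "h * Suc m = h * m + h" by simp
    then show ?case using Suc by (simp only: add sum.lessThan_Suc)
  qed simp
  finally show ?thesis by (simp add: trace_char_def)
qed

section \<open>Weil sums and their restriction to norm fibres\<close>

text \<open>Coprimality is recorded through \<open>bij\<close> and \<open>odd\<close>, which hold on
  each subfield, so that \<open>J\<close> and the whole field share the moment formulas. Even
  \<open>e\<close> are included; they occur in characteristic 2 only.\<close>

locale weil_exponent = finite_subfield F h for F :: "'a::{finite,field} set" and h +
  fixes e :: nat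
  assumes e_pos: "e > 0"
    and bij: "bij_betw (\<lambda>x. x ^ e) F F"
    and odd: "x \<in> F \<Longrightarrow> (- x) ^ e = - (x ^ e)"
begin

lemma zero_power_e [simp]: "(0 :: 'a) ^ e = 0"
  using e_pos by simp

definition W :: "'a \<Rightarrow> complex" where
  "W b = (\<Sum>x\<in>F. trace_char h (x ^ e + b * x))"

lemma W_eq: "b \<in> F \<Longrightarrow> W b = (\<Sum>x\<in>F. trace_char h (x ^ e) * trace_char h (b * x))"
  unfolding W_def by (intro sum.cong) (auto simp: trace_char_add)

lemma W_0: "W 0 = 0"
proof -
  have "W 0 = (\<Sum>x\<in>F. trace_char h (x ^ e))" by (simp add: W_def)
  also have "\<dots> = (\<Sum>x\<in>F. trace_char h (1 * x))"
    using sum.reindex_bij_betw[OF bij, of "trace_char h"] by simp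
  finally show ?thesis by (simp only: sum_trace_char[OF closed(2)]) simp
qed

text \<open>Fourier inversion on the additive group, the source of all three moments.
  \<open>odd\<close> moves the sign out of the power.\<close>

lemma sum_W_inversion:
  assumes u: "u \<in> F"
  shows "(\<Sum>b\<in>F. trace_char h (b * u) * W b) = of_nat (card F) * trace_char h (- (u ^ e))"
proof -
  have "(\<Sum>b\<in>F. trace_char h (b * u) * W b)
      = (\<Sum>b\<in>F. \<Sum>x\<in>F. trace_char h (x ^ e) * trace_char h ((u + x) * b))"
  proof (rule sum.cong[OF refl])
    fix b assume b: "b \<in> F"
    show "trace_char h (b * u) * W b = (\<Sum>x\<in>F. trace_char h (x ^ e) * trace_char h ((u + x) * b))"
      unfolding W_eq[OF b] sum_distrib_left
    proof (rule sum.cong[OF refl])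
      fix x assume x: "x \<in> F"
      have "trace_char h ((u + x) * b) = trace_char h (b * u) * trace_char h (b * x)"
        using trace_char_add[of "b * u" "b * x"] u x b by (simp add: algebra_simps)
      then show "trace_char h (b * u) * (trace_char h (x ^ e) * trace_char h (b * x))
          = trace_char h (x ^ e) * trace_char h ((u + x) * b)" by simp
    qed
  qed
  also have "\<dots> = (\<Sum>x\<in>F. trace_char h (x ^ e) * (\<Sum>b\<in>F. trace_char h ((u + x) * b)))"
    by (subst sum.swap) (simp add: sum_distrib_left)
  also have "\<dots> = (\<Sum>x\<in>F. if x = - u then of_nat (card F) * trace_char h (x ^ e) else 0)"
    using u by (intro sum.cong refl) (simp add: sum_trace_char add_eq_0_iff)
  also have "\<dots> = of_nat (card F) * trace_char h (- (u ^ e))"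
    using u by (simp add: odd)
  finally show ?thesis .
qed

lemma sum_W: "(\<Sum>b\<in>F. W b) = of_nat (card F)"
  using sum_W_inversion[of 0] e_pos by simp

lemma sum_W_square: "(\<Sum>b\<in>F. W b ^ 2) = of_nat (card F) ^ 2"
proof -
  have "(\<Sum>b\<in>F. W b ^ 2) = (\<Sum>b\<in>F. \<Sum>x\<in>F. trace_char h (x ^ e) * (trace_char h (b * x) * W b))"
    by (intro sum.cong refl) (simp add: power2_eq_square W_eq sum_distrib_right mult_ac)
  also have "\<dots> = (\<Sum>x\<in>F. trace_char h (x ^ e) * (\<Sum>b\<in>F. trace_char h (b * x) * W b))"
    by (subst sum.swap) (simp add: sum_distrib_left)
  also have "\<dots> = (\<Sum>x\<in>F. of_nat (card F))"
  proof (rule sum.cong[OF refl])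
    fix x assume x: "x \<in> F"
    have "trace_char h (x ^ e) * trace_char h (- (x ^ e)) = 1"
      using trace_char_add[of "x ^ e" "- (x ^ e)"] x by simp
    then show "trace_char h (x ^ e) * (\<Sum>b\<in>F. trace_char h (b * x) * W b) = of_nat (card F)"
      by (simp add: sum_W_inversion[OF x] mult_ac)
  qed
  finally show ?thesis by (simp add: power2_eq_square)
qed

text \<open>Two factors are expanded, with variables x and y, and inversion at x + y is applied to
  the third. This leaves the character of x^e + y^e - (x + y)^e, which by homogeneity reduces to y =
  1.\<close>

lemma sum_W_cube:
  "(\<Sum>b\<in>F. W b ^ 3) = of_nat (card F) ^ 2 * of_nat (card {x \<in> F. x ^ e + 1 = (x + 1) ^ e})"
proof -
  let ?q = "of_nat (card F) :: complex" and ?M = "{x \<in> F. x ^ e + 1 = (x + 1) ^ e}"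
  let ?s = "\<lambda>x y. x ^ e + y ^ e - (x + y) ^ e"
  have "(\<Sum>b\<in>F. W b ^ 3) = (\<Sum>b\<in>F. \<Sum>y\<in>F. \<Sum>x\<in>F.
      trace_char h (x ^ e) * trace_char h (y ^ e) * (trace_char h (b * (x + y)) * W b))"
  proof (rule sum.cong[OF refl])
    fix b assume b: "b \<in> F"
    have "W b ^ 3 = (W b * W b) * W b" by (simp add: power3_eq_cube)
    also have "W b * W b = (\<Sum>y\<in>F. \<Sum>x\<in>F. (trace_char h (y ^ e) * trace_char h (b * y)) *
        (trace_char h (x ^ e) * trace_char h (b * x)))"
      unfolding W_eq[OF b] by (rule sum_product)
    also have "\<dots> = (\<Sum>y\<in>F. \<Sum>x\<in>F. trace_char h (x ^ e) * trace_char h (y ^ e) * trace_char h (b * (x + y)))"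
    proof ((rule sum.cong[OF refl])+)
      fix y x assume "y \<in> F" "x \<in> F"
      then have "trace_char h (b * (x + y)) = trace_char h (b * x) * trace_char h (b * y)"
        using b trace_char_add[of "b * x" "b * y"] by (simp add: distrib_left)
      then show "(trace_char h (y ^ e) * trace_char h (b * y)) * (trace_char h (x ^ e) * trace_char h (b * x))
         = trace_char h (x ^ e) * trace_char h (y ^ e) * trace_char h (b * (x + y))" by simp
    qed
    finally show "W b ^ 3 = (\<Sum>y\<in>F. \<Sum>x\<in>F.
      trace_char h (x ^ e) * trace_char h (y ^ e) * (trace_char h (b * (x + y)) * W b))"
      by (simp add: sum_distrib_right mult.assoc)
  qed
  also have "\<dots> = (\<Sum>y\<in>F. \<Sum>b\<in>F. \<Sum>x\<in>F.
      trace_char h (x ^ e) * trace_char h (y ^ e) * (trace_char h (b * (x + y)) * W b))"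
    by (rule sum.swap)
  also have "\<dots> = (\<Sum>y\<in>F. \<Sum>x\<in>F. \<Sum>b\<in>F.
      trace_char h (x ^ e) * trace_char h (y ^ e) * (trace_char h (b * (x + y)) * W b))"
    by (rule sum.cong[OF refl], rule sum.swap)
  also have "\<dots> = (\<Sum>y\<in>F. \<Sum>x\<in>F. ?q * trace_char h (?s x y))"
  proof ((rule sum.cong[OF refl])+)
    fix y x assume yx: "y \<in> F" "x \<in> F"
    have "trace_char h (?s x y)
        = trace_char h (x ^ e) * trace_char h (y ^ e) * trace_char h (- ((x + y) ^ e))"
      using yx trace_char_add[of "x ^ e" "y ^ e"] trace_char_add[of "x ^ e + y ^ e" "- ((x + y) ^ e)"]
      by simp
    moreover have "(\<Sum>b\<in>F. trace_char h (x ^ e) * trace_char h (y ^ e) * (trace_char h (b * (x + y)) * W b))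
        = trace_char h (x ^ e) * trace_char h (y ^ e) * (?q * trace_char h (- ((x + y) ^ e)))"
      using yx by (simp only: sum_distrib_left[symmetric] sum_W_inversion closed)
    ultimately show "(\<Sum>b\<in>F. trace_char h (x ^ e) * trace_char h (y ^ e) * (trace_char h (b * (x + y)) * W b))
        = ?q * trace_char h (?s x y)" by simp
  qed
  also have "\<dots> = ?q * (\<Sum>y\<in>F. \<Sum>x\<in>F. trace_char h (?s x y))"
    by (simp add: sum_distrib_left)
  also have "(\<Sum>y\<in>F. \<Sum>x\<in>F. trace_char h (?s x y))
      = (\<Sum>x\<in>F. trace_char h (?s x 0)) + (\<Sum>y\<in>F - {0}. \<Sum>x\<in>F. trace_char h (?s x y))"
    by (rule sum.remove) auto
  also have "(\<Sum>y\<in>F - {0}. \<Sum>x\<in>F. trace_char h (?s x y))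
      = (\<Sum>y\<in>F - {0}. \<Sum>x\<in>F. trace_char h (?s x 1 * y ^ e))"
  proof (rule sum.cong[OF refl])
    fix y assume y: "y \<in> F - {0}"
    have "(\<Sum>x\<in>F. trace_char h (?s x y)) = (\<Sum>x\<in>F. trace_char h (?s (x * y) y))"
      by (rule sum.reindex_bij_witness[where i = "\<lambda>x. x * y" and j = "\<lambda>x. x * inverse y"])
         (use y in \<open>auto simp: mult.assoc\<close>)
    also have "\<dots> = (\<Sum>x\<in>F. trace_char h (?s x 1 * y ^ e))"
    proof (rule sum.cong[OF refl])
      fix x
      have "(x * y + y) ^ e = (x + 1) ^ e * y ^ e"
        unfolding power_mult_distrib[symmetric] by (simp add: algebra_simps)
      then show "trace_char h (?s (x * y) y) = trace_char h (?s x 1 * y ^ e)"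
        by (simp add: algebra_simps power_mult_distrib)
    qed
    finally show "(\<Sum>x\<in>F. trace_char h (?s x y)) = (\<Sum>x\<in>F. trace_char h (?s x 1 * y ^ e))" .
  qed
  also have "\<dots> = (\<Sum>x\<in>F. \<Sum>y\<in>F - {0}. trace_char h (?s x 1 * y ^ e))"
    by (rule sum.swap)
  \<comment> \<open>Orthogonality applies because \<open>y ^ e\<close> runs through
    \<open>F\<close>; the 1 is the missing term at \<open>y = 0\<close>. Summed over x these ones
    give -q, which cancels the part with \<open>y = 0\<close> split off before.\<close>
  also have "\<dots> = (\<Sum>x\<in>F. (if ?s x 1 = 0 then ?q else 0) - 1)"
  proof (rule sum.cong[OF refl])
    fix x assume x: "x \<in> F"
    have s: "?s x 1 \<in> F" using x by simp
    have "(\<Sum>y\<in>F. trace_char h (?s x 1 * y ^ e)) = (\<Sum>y\<in>F. trace_char h (?s x 1 * y))"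
      by (rule sum.reindex_bij_betw[OF bij])
    also have "\<dots> = (if ?s x 1 = 0 then ?q else 0)" by (rule sum_trace_char[OF s])
    finally have "(\<Sum>y\<in>F. trace_char h (?s x 1 * y ^ e)) = (if ?s x 1 = 0 then ?q else 0)" .
    moreover have "(\<Sum>y\<in>F. trace_char h (?s x 1 * y ^ e))
        = 1 + (\<Sum>y\<in>F - {0}. trace_char h (?s x 1 * y ^ e))"
      using sum.remove[of F 0 "\<lambda>y. trace_char h (?s x 1 * y ^ e)"] e_pos by simp
    ultimately have "1 + (\<Sum>y\<in>F - {0}. trace_char h (?s x 1 * y ^ e)) = (if ?s x 1 = 0 then ?q else 0)"
      by (rule trans[OF sym, rotated])
    then show "(\<Sum>y\<in>F - {0}. trace_char h (?s x 1 * y ^ e)) = (if ?s x 1 = 0 then ?q else 0) - 1"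
      by (simp only: eq_diff_eq add.commute)
  qed
  also have "\<dots> = ?q * of_nat (card ?M) - ?q"
  proof -
    have "(\<Sum>x\<in>F. (if ?s x 1 = 0 then ?q else 0)) = (\<Sum>x\<in>F. if x ^ e + 1 = (x + 1) ^ e then ?q else 0)"
      by (simp only: power_one right_minus_eq)
    also have "\<dots> = (\<Sum>x\<in>?M. ?q)"
      by (rule sum.inter_filter[symmetric]) simp
    finally have "(\<Sum>x\<in>F. (if ?s x 1 = 0 then ?q else 0)) = ?q * of_nat (card ?M)" by simp
    then show ?thesis by (simp only: sum_subtractf) simp
  qed
  also have "(\<Sum>x\<in>F. trace_char h (?s x 0)) = ?q" by simp
  finally show ?thesis by (simp add: power2_eq_square)
qed

lemma W_minus_1:
  assumes "b \<in> F"
  shows "W b - 1 = (\<Sum>x\<in>F - {0}. trace_char h (x ^ e) * trace_char h (b * x))"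
  unfolding W_eq[OF assms]
  using sum.remove[of F 0 "\<lambda>x. trace_char h (x ^ e) * trace_char h (b * x)"] e_pos by simp

end

lemma conv_pow_to_ac:
  "conv_pow (to_ac ` G) f n (to_ac t) = conv_pow G (\<lambda>s. f (to_ac s)) n t"
proof (induction n arbitrary: t)
  case 0
  have "to_ac t = 1 \<longleftrightarrow> t = 1" by (metis to_ac_1 to_ac_eq_iff)
  then show ?case by simp
next
  case (Suc n)
  have "inj_on to_ac G" using inj_to_ac by (rule inj_on_subset) auto
  then have "conv_pow (to_ac ` G) f (Suc n) (to_ac t)
    = (\<Sum>s\<in>G. f (to_ac s) * conv_pow (to_ac ` G) f n (to_ac (t / s)))"
    by (simp add: conv_def sum.reindex)
  then show ?case by (simp only: Suc.IH conv_pow.simps conv_def)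
qed

section \<open>The norm to a subfield and its fibres\<close>

locale extension = J: weil_exponent J h e + K: weil_exponent "UNIV :: 'a set" "h * m" e
  for J :: "'a::{finite,field} set" and h m e :: nat
begin

definition Q :: nat where "Q = CHAR('a) ^ h"

text \<open>The norm from the whole field to \<open>J\<close>, as \<open>Q\<close> is the order of
  \<open>J\<close>.\<close>

definition N :: "'a \<Rightarrow> 'a" where "N x = (\<Prod>j<m. x ^ (Q ^ j))"

lemma m_pos: "m > 0"
  using K.h_pos by simp

lemma card_UNIV_eq: "CARD('a) = Q ^ m"
  using K.card_F by (simp add: Q_def power_mult)

lemma Q_gt_1: "Q > 1"
  unfolding Q_def using J.h_pos prime_gt_1_nat[OF prime_CHAR_finite[where ?'a='a]]
  by (intro one_less_power)

sublocale G: finite_mult_group "J - {0}"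
  by (rule finite_mult_group_subfield[OF J.subfield])

lemma N_mult: "N (x * y) = N x * N y"
  by (simp add: N_def power_mult_distrib prod.distrib)

lemma N_power: "N (x ^ k) = N x ^ k"
  by (simp add: N_def prod_power_distrib power_mult[symmetric] mult.commute)

lemma N_in:
  assumes "x \<noteq> 0" shows "N x \<in> J - {0}"
proof -
  have "N x ^ Q * x = (\<Prod>j<m. x ^ (Q ^ Suc j)) * x"
    by (simp add: N_def prod_power_distrib power_mult[symmetric] mult.commute)
  also have "\<dots> = (\<Prod>j<Suc m. x ^ (Q ^ j))"
    by (simp only: prod.lessThan_Suc_shift power_0 power_one_right mult.commute)
  also have "\<dots> = N x * x ^ (Q ^ m)" by (simp add: N_def)
  also have "x ^ (Q ^ m) = x"
    using subfield_power_card[OF subfield_UNIV, of x] card_UNIV_eq by simp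
  finally have "N x ^ Q = N x" using assms by simp
  then show ?thesis using assms J.F_eq by (auto simp: Q_def N_def)
qed

lemma sum_N_fibres:
  "(\<Sum>x\<in>UNIV - {0}. f x) = (\<Sum>t\<in>J - {0}. \<Sum>x | N x = t. f x)"
proof -
  have "N x = 0 \<longleftrightarrow> x = 0" for x using m_pos Q_gt_1 by (auto simp: N_def)
  then have "{x \<in> UNIV - {0}. N x = t} = {x. N x = t}" if "t \<in> J - {0}" for t
    using that by auto
  moreover have "(\<Sum>t\<in>J - {0}. \<Sum>x\<in>{x \<in> UNIV - {0}. N x = t}. f x) = (\<Sum>x\<in>UNIV - {0}. f x)"
    by (rule sum.group) (use N_in in auto)
  ultimately show ?thesis by simp
qed

text \<open>A fibre consists of roots of X^M - t, with M the sum in the statement, so it has at most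
  M elements. The |J| - 1 fibres together have (|J| - 1) M elements, so none can have fewer.\<close>

lemma card_N_fibre:
  assumes "t \<in> J - {0}" shows "card {x. N x = t} = (\<Sum>j<m. Q ^ j)"
proof -
  let ?M = "\<Sum>j<m. Q ^ j"
  have M: "?M > 0" using m_pos Q_gt_1 by (intro sum_pos) auto
  have le: "card {x. N x = t} \<le> ?M" for t
  proof -
    let ?f = "Polynomial.monom 1 ?M - [:t:] :: 'a poly"
    have "Polynomial.coeff ?f ?M = 1" using M by (cases ?M) auto
    then have nz: "?f \<noteq> 0" by (metis coeff_0 zero_neq_one)
    have "{x. N x = t} = {x. poly ?f x = 0}"
      by (simp add: N_def poly_monom power_sum)
    then have "card {x. N x = t} \<le> Polynomial.degree ?f" using card_poly_roots_bound[OF nz] by simp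
    also have "\<dots> \<le> ?M" by (intro degree_diff_le) (auto simp: degree_monom_eq)
    finally show ?thesis .
  qed
  have "card (UNIV - {0 :: 'a}) = (\<Sum>t\<in>J - {0}. card {x. N x = t})"
    using sum_N_fibres[of "\<lambda>_. 1 :: nat"] by simp
  moreover have "card (UNIV - {0 :: 'a}) = Q ^ m - 1"
    using card_UNIV_eq by (simp add: card_Diff_singleton)
  moreover have "Q ^ m - 1 = (Q - 1) * ?M"
  proof -
    have "int (Q ^ m - 1) = int ((Q - 1) * ?M)"
      using Q_gt_1 power_diff_1_eq[of "int Q" m] by (simp add: of_nat_diff)
    then show ?thesis by (simp only: of_nat_eq_iff)
  qed
  moreover have "card (J - {0}) = Q - 1"
    using J.card_F by (simp add: Q_def card_Diff_singleton)
  ultimately have eq: "(\<Sum>t\<in>J - {0}. card {x. N x = t}) = (\<Sum>t\<in>J - {0}. ?M)" by simp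
  show ?thesis
  proof (rule ccontr)
    assume "card {x. N x = t} \<noteq> ?M"
    with le[of t] have "card {x. N x = t} < ?M" by simp
    then have "(\<Sum>t\<in>J - {0}. card {x. N x = t}) < (\<Sum>t\<in>J - {0}. ?M)"
      using assms le by (intro sum_strict_mono_ex1) auto
    with eq show False by simp
  qed
qed

text \<open>Summed against a multiplicative character of \<open>J - {0}\<close>, this is the
  classical relation between Gauss sums. Both fields are moved into the algebraic closure, where
  \<open>orbit_sum_eq_conv_pow\<close> applies.\<close>

lemma davenport_hasse:
  assumes t: "t \<in> J - {0}"
  shows "(\<Sum>x | N x = t. trace_char (h * m) x) = (- 1) ^ (m - 1) * conv_pow (J - {0}) (trace_char h) m t"
proof -
  let ?\<psi> = "\<lambda>y :: 'a alg_closure. trace_char h (of_ac y)"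
  \<comment> \<open>The image of \<open>F\<close> lies in the root set of X^n - X and has n
    elements, so it exhausts that set.\<close>
  have fixed: "{x :: 'a alg_closure. x ^ n = x} = to_ac ` F"
    if "n > 1" "card F = n" "\<And>x. x \<in> F \<Longrightarrow> x ^ n = x" for n and F :: "'a set"
  proof (rule card_seteq[symmetric])
    show "finite {x :: 'a alg_closure. x ^ n = x}" by (rule finite_power_fixed(1)[OF that(1)])
    show "to_ac ` F \<subseteq> {x. x ^ n = x}" using that(3) by (auto simp flip: to_ac_power)
    have "card (to_ac ` F) = n"
      using that(2) inj_on_subset[OF inj_to_ac] by (subst card_image) auto
    then show "card {x :: 'a alg_closure. x ^ n = x} \<le> card (to_ac ` F)"
      using finite_power_fixed(2)[OF that(1), where ?'b = "'a alg_closure"] by simp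
  qed
  have fixJ: "{x :: 'a alg_closure. x ^ Q = x} = to_ac ` J"
    using Q_gt_1 J.card_F subfield_power_card[OF J.subfield] by (intro fixed) (auto simp: Q_def)
  have fixK: "{x :: 'a alg_closure. x ^ (Q ^ m) = x} = range to_ac"
    using Q_gt_1 m_pos card_UNIV_eq subfield_power_card[OF subfield_UNIV[where ?'a='a]]
    by (intro fixed one_less_power) auto
  interpret A: frobenius_character Q h ?\<psi>
  proof
    show "prime CHAR('a alg_closure)" using prime_CHAR_finite[where ?'a='a] by simp
    show "Q = CHAR('a alg_closure) ^ h" by (simp add: Q_def)
    show "h > 0" by (rule J.h_pos)
    show "?\<psi> 0 = 1" by simp
    show "?\<psi> (x + y) = ?\<psi> x * ?\<psi> y" if xy: "x ^ Q = x" "y ^ Q = y" for x y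
    proof -
      from xy fixJ obtain u v where "x = to_ac u" "y = to_ac v" "u \<in> J" "v \<in> J" by blast
      then show ?thesis by (simp add: J.trace_char_add flip: to_ac_add)
    qed
    obtain c where "c \<in> J" "trace_char h c \<noteq> 1" using J.trace_char_nontrivial by blast
    then show "\<exists>c. c ^ Q = c \<and> ?\<psi> c \<noteq> 1" using fixJ by (intro exI[of _ "to_ac c"]) auto
  qed
  have AJ: "A.J - {0} = to_ac ` (J - {0})"
    unfolding A.J_def fixJ by auto
  obtain k where k: "m = Suc k" using m_pos by (cases m) auto
  have eq: "{x :: 'a alg_closure. x ^ (Q ^ m) = x \<and> (\<Prod>i<m. x ^ (Q ^ i)) = to_ac t} = to_ac ` {x. N x = t}"
  proof -
    have "{x :: 'a alg_closure. x ^ (Q ^ m) = x \<and> (\<Prod>i<m. x ^ (Q ^ i)) = to_ac t}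
        = {x \<in> range to_ac. (\<Prod>i<m. x ^ (Q ^ i)) = to_ac t}"
      unfolding fixK[symmetric] by simp
    also have "\<dots> = to_ac ` {x. N x = t}"
      by (auto simp: N_def image_iff simp flip: to_ac_power to_ac_prod)
    finally show ?thesis .
  qed
  have "(\<Sum>x | N x = t. trace_char (h * m) x) = A.orbit_sum m (to_ac t)"
    unfolding A.orbit_sum_def eq
    by (subst sum.reindex)
       (auto intro: inj_on_subset[OF inj_to_ac] simp: trace_char_mult Q_def simp flip: to_ac_power to_ac_sum)
  also have "\<dots> = (- 1) ^ k * conv_pow (to_ac ` (J - {0})) ?\<psi> m (to_ac t)"
    using A.orbit_sum_eq_conv_pow[of "to_ac t" k] t unfolding AJ k by blast
  also have "\<dots> = (- 1) ^ (m - 1) * conv_pow (J - {0}) (trace_char h) m t"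
    by (simp only: conv_pow_to_ac of_ac_to_ac k diff_Suc_1)
  finally show ?thesis .
qed

lemma bij_power: "bij_betw (\<lambda>x. x ^ e) (J - {0}) (J - {0})"
proof -
  have "bij_betw (\<lambda>x. x ^ e) (J - {0}) (J - {0 ^ e})"
    using J.bij by (rule bij_betw_DiffI[of _ J J "{0}" "{0 ^ e}"]) auto
  then show ?thesis using J.e_pos by simp
qed

text \<open>Powering by \<open>e\<close> permutes the field and commutes with \<open>N\<close>. It
  reaches the whole fibre over \<open>s ^ e\<close> because it is injective on
  \<open>J - {0}\<close>.\<close>

lemma sum_N_fibre_power:
  assumes s: "s \<in> J - {0}"
  shows "(\<Sum>x | N x = s. f (x ^ e)) = (\<Sum>x | N x = s ^ e. f x)"
proof (rule sum.reindex_bij_betw)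
  have inj: "inj_on (\<lambda>x. x ^ e) (J - {0})" using bij_power by (simp add: bij_betw_def)
  have "(\<lambda>x. x ^ e) ` {x. N x = s} = {x. N x = s ^ e}"
  proof (intro equalityI subsetI)
    fix y assume y: "y \<in> {x. N x = s ^ e}"
    obtain x where x: "y = x ^ e" using K.bij by (auto simp: bij_betw_def image_iff)
    have "y \<noteq> 0" using y s m_pos Q_gt_1 by (auto simp: N_def power_0_left)
    then have "x \<noteq> 0" using x J.e_pos by auto
    then have "N x \<in> J - {0}" by (rule N_in)
    moreover have "N x ^ e = s ^ e" using y x by (simp add: N_power)
    ultimately have "N x = s" using inj s by (auto simp: inj_on_def)
    with x show "y \<in> (\<lambda>x. x ^ e) ` {x. N x = s}" by blast
  qed (auto simp: N_power)
  moreover have "inj_on (\<lambda>x. x ^ e) {x. N x = s}"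
    using K.bij by (auto simp: bij_betw_def intro: inj_on_subset)
  ultimately show "bij_betw (\<lambda>x. x ^ e) {x. N x = s} {x. N x = s ^ e}"
    by (simp add: bij_betw_def)
qed

text \<open>Without its term at x = 0 a Weil sum is a multiplicative correlation of two
  additive-character functions, the counterpart of a product of two Gauss sums.
  \<open>davenport_hasse\<close> is applied to both factors.\<close>

lemma sum_N_fibre_W_minus_1:
  assumes t: "t \<in> J - {0}"
  shows "(\<Sum>a | N a = t. K.W a - 1) = conv_pow (J - {0}) (\<lambda>b. J.W b - 1) m t"
proof -
  let ?G = "J - {0}" and ?\<psi> = "trace_char h :: 'a \<Rightarrow> complex" and ?\<psi>K = "trace_char (h * m) :: 'a \<Rightarrow> complex"
  let ?P = "conv_pow ?G ?\<psi> m" and ?L = "\<lambda>t. \<Sum>x | N x = t. ?\<psi>K x"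
  have "(\<Sum>a | N a = t. K.W a - 1) = (\<Sum>a | N a = t. \<Sum>x\<in>UNIV - {0}. ?\<psi>K (x ^ e) * ?\<psi>K (a * x))"
    by (simp add: K.W_minus_1)
  also have "\<dots> = (\<Sum>x\<in>UNIV - {0}. ?\<psi>K (x ^ e) * (\<Sum>a | N a = t. ?\<psi>K (a * x)))"
    by (subst sum.swap) (simp add: sum_distrib_left)
  also have "\<dots> = (\<Sum>x\<in>UNIV - {0}. ?\<psi>K (x ^ e) * ?L (t * N x))"
  proof (rule sum.cong[OF refl])
    fix x :: 'a assume "x \<in> UNIV - {0}"
    then have x: "x \<noteq> 0" by simp
    have nx: "N x \<noteq> 0" using N_in[OF x] by simp
    have N1: "N (y / x) = N y / N x" for y
      using N_mult[of "y / x" x] x nx by (simp add: field_simps)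
    have "(\<Sum>a | N a = t. ?\<psi>K (a * x)) = ?L (t * N x)"
      by (rule sum.reindex_bij_witness[where i = "\<lambda>y. y / x" and j = "\<lambda>a. a * x"])
         (use x nx in \<open>auto simp: N_mult N1\<close>)
    then show "?\<psi>K (x ^ e) * (\<Sum>a | N a = t. ?\<psi>K (a * x)) = ?\<psi>K (x ^ e) * ?L (t * N x)" by simp
  qed
  also have "\<dots> = (\<Sum>s\<in>?G. \<Sum>x | N x = s. ?\<psi>K (x ^ e) * ?L (t * N x))"
    by (rule sum_N_fibres)
  also have "\<dots> = (\<Sum>s\<in>?G. ?L (s ^ e) * ?L (t * s))"
  proof (rule sum.cong[OF refl])
    fix s assume s: "s \<in> ?G"
    have "(\<Sum>x | N x = s. ?\<psi>K (x ^ e) * ?L (t * N x)) = (\<Sum>x | N x = s. ?\<psi>K (x ^ e)) * ?L (t * s)"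
      by (simp add: sum_distrib_right)
    then show "(\<Sum>x | N x = s. ?\<psi>K (x ^ e) * ?L (t * N x)) = ?L (s ^ e) * ?L (t * s)"
      by (simp only: sum_N_fibre_power[OF s, of ?\<psi>K])
  qed
  also have "\<dots> = (\<Sum>s\<in>?G. ?P (s ^ e) * ?P (t * s))"
  proof (rule sum.cong[OF refl])
    fix s assume s: "s \<in> ?G"
    let ?\<epsilon> = "(- 1) ^ (m - 1) :: complex"
    have sq: "?\<epsilon> * ?\<epsilon> = 1" by (simp add: power_mult_distrib[symmetric])
    have "(?\<epsilon> * x) * (?\<epsilon> * y) = (?\<epsilon> * ?\<epsilon>) * (x * y)" for x y by (simp only: mult_ac)
    then show "?L (s ^ e) * ?L (t * s) = ?P (s ^ e) * ?P (t * s)"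
      unfolding davenport_hasse[OF G.power_in[OF s]] davenport_hasse[OF G.mult_in[OF t s]]
      by (simp only: sq mult_1)
  qed
  finally have 1: "(\<Sum>a | N a = t. K.W a - 1) = (\<Sum>s\<in>?G. ?P (s ^ e) * ?P (t * s))" .
  \<comment> \<open>The inversion of \<open>s\<close> turns the correlation over \<open>J\<close>
    into a convolution, whose powers split by \<open>conv_pow_conv\<close>.\<close>
  define B where "B = (\<lambda>s. ?\<psi> ((1 / s) ^ e))"
  have V: "J.W b - 1 = conv ?G B ?\<psi> b" if b: "b \<in> ?G" for b
  proof -
    have "J.W b - 1 = (\<Sum>x\<in>?G. ?\<psi> (x ^ e) * ?\<psi> (b * x))"
      using b by (intro J.W_minus_1) simp
    also have "\<dots> = (\<Sum>x\<in>?G. (\<lambda>x. ?\<psi> (x ^ e) * ?\<psi> (b * x)) (1 / x))"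
      by (rule G.sum_divide_reflect[OF G.one_in, symmetric])
    finally have "J.W b - 1 = (\<Sum>x\<in>?G. (\<lambda>x. ?\<psi> (x ^ e) * ?\<psi> (b * x)) (1 / x))" .
    then show ?thesis by (simp add: conv_def B_def)
  qed
  have bij': "bij_betw (\<lambda>s. (1 / s) ^ e) ?G ?G"
  proof -
    have "bij_betw (\<lambda>s. 1 / s) ?G ?G"
      by (rule bij_betwI[where g = "\<lambda>s. 1 / s"]) (use G.divide_in[OF G.one_in] in auto)
    from bij_betw_trans[OF this bij_power] show ?thesis by (simp add: comp_def)
  qed
  have "conv_pow ?G (\<lambda>b. J.W b - 1) m t = conv_pow ?G (conv ?G B ?\<psi>) m t"
    by (rule G.conv_pow_cong[OF V t])
  also have "\<dots> = conv ?G (conv_pow ?G B m) ?P t" by (rule G.conv_pow_conv[OF t])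
  also have "\<dots> = (\<Sum>s\<in>?G. (\<lambda>s. ?P (s ^ e) * ?P (t * s)) (1 / s))"
    unfolding conv_def
  proof (rule sum.cong[OF refl])
    fix s assume s: "s \<in> ?G"
    have "conv_pow ?G B m s = ?P ((1 / s) ^ e)"
      unfolding B_def by (rule G.conv_pow_automorphism[OF bij' _ s]) (simp add: power_divide)
    then show "conv_pow ?G B m s * ?P (t / s) = (\<lambda>s. ?P (s ^ e) * ?P (t * s)) (1 / s)" by simp
  qed
  also have "\<dots> = (\<Sum>s\<in>?G. ?P (s ^ e) * ?P (t * s))"
    by (rule G.sum_divide_reflect[OF G.one_in])
  finally show ?thesis using 1 by simp
qed

lemma sum_J_W: "(\<Sum>b\<in>J - {0}. J.W b) = of_nat Q"
  using sum.remove[of J 0 J.W] J.sum_W J.W_0 J.card_F by (simp add: Q_def)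

lemma sum_K_W: "(\<Sum>a\<in>UNIV - {0}. K.W a) = of_nat Q ^ m"
  using sum.remove[of UNIV 0 K.W] K.sum_W K.W_0 card_UNIV_eq by simp

text \<open>Passing from \<open>W - 1\<close> to \<open>W\<close> changes both sides by constants:
  the left because the fibres have equal size, the right by \<open>conv_pow_add_const\<close>. The
  remaining constant difference is 0, since both sides have total \<open>Q ^ m\<close>.\<close>

theorem sum_N_fibre_W:
  assumes t: "t \<in> J - {0}"
  shows "(\<Sum>a | N a = t. K.W a) = conv_pow (J - {0}) J.W m t"
proof -
  let ?G = "J - {0}"
  define D where "D = (\<lambda>t. (\<Sum>a | N a = t. K.W a) - conv_pow ?G J.W m t)"
  have D: "D t = D 1" if t: "t \<in> ?G" for t
  proof -
    have *: "D t = conv_pow ?G (\<lambda>b. J.W b - 1) m t - conv_pow ?G J.W m t + of_nat (\<Sum>j<m. Q ^ j)"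
      if t: "t \<in> ?G" for t
    proof -
      have "(\<Sum>a | N a = t. K.W a) = (\<Sum>a | N a = t. K.W a - 1) + of_nat (card {a. N a = t})"
        by (simp add: sum_subtractf)
      then show ?thesis
        unfolding D_def by (simp add: sum_N_fibre_W_minus_1[OF t] card_N_fibre[OF t])
    qed
    show ?thesis
      using G.conv_pow_add_const[OF t G.one_in, of J.W "- 1" m] *[OF t] *[OF G.one_in] by simp
  qed
  have "(\<Sum>t\<in>?G. D t) = (\<Sum>t\<in>?G. \<Sum>a | N a = t. K.W a) - (\<Sum>t\<in>?G. 1 * conv_pow ?G J.W m t)"
    by (simp add: D_def sum_subtractf)
  also have "(\<Sum>t\<in>?G. \<Sum>a | N a = t. K.W a) = of_nat Q ^ m"
    using sum_N_fibres[of K.W] sum_K_W by simp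
  also have "(\<Sum>t\<in>?G. 1 * conv_pow ?G J.W m t) = of_nat Q ^ m"
    using G.sum_conv_pow[of "\<lambda>_. 1" J.W m] sum_J_W by simp
  finally have "(\<Sum>t\<in>?G. D t) = 0" by simp
  moreover have "(\<Sum>t\<in>?G. D t) = (\<Sum>t\<in>?G. D 1)" by (rule sum.cong[OF refl D])
  ultimately have "of_nat (card ?G) * D 1 = 0" by simp
  moreover have "card ?G \<noteq> 0" using G.one_in unfolding card_0_eq[OF G.finite_G] by blast
  ultimately have "D 1 = 0" by simp
  with D[OF t] have "D t = 0" by simp
  then show ?thesis by (simp only: D_def right_minus_eq)
qed

end

section \<open>Weil sums over a quadratic extension\<close>

lemma power_eq_of_cong:
  fixes z :: "'a::field"
  assumes "z ^ n = 1" "[a = b] (mod n)" shows "z ^ a = z ^ b"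
proof -
  have "z ^ a = z ^ (n * (a div n) + a mod n)" for a by simp
  then have *: "z ^ a = z ^ (a mod n)" for a
    using assms(1) by (simp only: power_add power_mult power_one mult_1)
  show ?thesis using *[of a] *[of b] assms(2) by (simp add: cong_def)
qed

lemma (in finite_mult_group) power_card: "x \<in> G \<Longrightarrow> x ^ card G = 1"
proof -
  assume x: "x \<in> G"
  have "(\<Prod>y\<in>G. y) = (\<Prod>y\<in>G. x * y)"
    by (rule prod.reindex_bij_witness[where i = "\<lambda>y. x * y" and j = "\<lambda>y. y / x"])
       (use x nonzero in auto)
  also have "\<dots> = x ^ card G * (\<Prod>y\<in>G. y)" by (simp add: prod.distrib)
  finally show ?thesis using nonzero by auto
qed

text \<open>Fourier inversion with characters valued in the field that contains \<open>G\<close>.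
  Geometric sums of roots of unity give the orthogonality, and |G| has to be invertible.\<close>

lemma (in finite_mult_group) fourier_vanish:
  assumes "of_nat (card G) \<noteq> (0 :: 'b)"
    and zero: "\<And>j. (\<Sum>b\<in>G. b ^ j * g b) = 0" and c: "c \<in> G"
  shows "g c = 0"
proof -
  have geo: "(\<Sum>j<card G. (b / c) ^ j) = (if b = c then of_nat (card G) else 0)" if b: "b \<in> G" for b
  proof (cases "b = c")
    case False
    then have "b / c \<noteq> 1" using nonzero[OF c] by simp
    then show ?thesis using False power_card[OF divide_in[OF b c]] by (simp add: geometric_sum)
  qed (use nonzero[OF c] in simp)
  have "0 = (\<Sum>j<card G. (1 / c) ^ j * (\<Sum>b\<in>G. b ^ j * g b))" by (simp add: zero)
  also have "\<dots> = (\<Sum>j<card G. \<Sum>b\<in>G. g b * (b / c) ^ j)"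
    by (simp add: sum_distrib_left power_divide mult_ac)
  also have "\<dots> = (\<Sum>b\<in>G. g b * (\<Sum>j<card G. (b / c) ^ j))"
    by (subst sum.swap) (simp add: sum_distrib_left)
  also have "\<dots> = (\<Sum>b\<in>G. if b = c then g b * of_nat (card G) else 0)"
    by (intro sum.cong refl) (simp add: geo)
  also have "\<dots> = g c * of_nat (card G)" using c by simp
  finally show ?thesis using assms(1) by simp
qed

lemma conv_pow_of_int:
  "conv_pow G (\<lambda>b. of_int (f b)) n t = of_int (conv_pow G f n t)"
  by (induction n arbitrary: t) (auto simp: conv_def)

context finite_subfield
begin

text \<open>This lets \<open>e\<close> be multiplied by powers of p without changing the Weil
  sum.\<close>

lemma trace_char_frobenius:
  assumes "x \<in> F" shows "trace_char h (x ^ (CHAR('a) ^ k)) = trace_char h x"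
proof (induction k)
  case (Suc k)
  let ?p = "CHAR('a)"
  have "trace_char h (y ^ ?p) = trace_char h y" if y: "y \<in> F" for y
  proof -
    have "(\<Sum>i<h. (y ^ ?p) ^ (?p ^ i)) + y = (\<Sum>i<Suc h. y ^ (?p ^ i))"
      by (simp only: sum.lessThan_Suc_shift power_mult[symmetric] power_Suc power_0 power_one_right add.commute)
    also have "\<dots> = (\<Sum>i<h. y ^ (?p ^ i)) + y" using y F_eq by auto
    finally show ?thesis by (simp add: trace_char_def)
  qed
  from this[of "x ^ (?p ^ k)"] Suc assms show ?case
    by (simp add: power_mult[symmetric] mult.commute)
qed simp

end

text \<open>Niho's argument: \<open>f\<close> acts as the identity on \<open>I\<close>, so the Weil sums over \<open>J\<close>
  only depend on the number of zeros of the relative trace of \<open>x ^ f + b * x\<close>.\<close>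

locale niho = I: finite_subfield I g + J: weil_exponent J "2 * g" e
  for I J :: "'a::{finite,field} set" and g e :: nat +
  fixes k :: nat
  assumes I_subset: "I \<subseteq> J"
    and fixes_I: "y \<in> I \<Longrightarrow> y ^ (e * CHAR('a) ^ k) = y"
begin

definition f :: nat where "f = e * CHAR('a) ^ k"
definition r :: nat where "r = CHAR('a) ^ g"

text \<open>\<open>u + u ^ r\<close> is the trace from \<open>J\<close> to \<open>I\<close>, the
  extension being quadratic.\<close>

definition zeros :: "'a \<Rightarrow> 'a set" where
  "zeros b = {x \<in> J. (x ^ f + b * x) + (x ^ f + b * x) ^ r = 0}"

definition w :: "'a \<Rightarrow> int" where "w b = int (card (zeros b)) - int r"

lemma card_I: "card I = r" by (simp add: r_def I.card_F)

lemma card_J: "card J = r ^ 2" by (simp add: r_def J.card_F power_mult[symmetric] mult.commute)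

lemma r_gt_1: "r > 1" using card_subfield_ge_2[OF I.subfield] card_I by simp

lemma I_eq: "I = {x. x ^ r = x}" using I.F_eq by (simp add: r_def)

lemma frob_r_add: "(x + y :: 'a) ^ r = x ^ r + y ^ r"
  by (rule freshmans_dream'[OF prime_CHAR_finite r_def])

lemma rel_trace_in_I:
  assumes "u \<in> J" shows "u + u ^ r \<in> I"
proof -
  have "u ^ (r * r) = u"
    using subfield_power_card[OF J.subfield assms] by (simp add: card_J power2_eq_square)
  then have "(u + u ^ r) ^ r = u + u ^ r"
    by (simp add: frob_r_add power_mult[symmetric] add.commute)
  then show ?thesis using I_eq by simp
qed

lemma scale_I:
  assumes y: "y \<in> I"
  shows "((y * x) ^ f + b * (y * x)) + ((y * x) ^ f + b * (y * x)) ^ r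
    = y * ((x ^ f + b * x) + (x ^ f + b * x) ^ r)"
proof -
  have "y ^ f = y" using fixes_I[OF y] by (simp add: f_def)
  then have 1: "(y * x) ^ f + b * (y * x) = y * (x ^ f + b * x)"
    by (simp add: power_mult_distrib algebra_simps)
  have "y ^ r = y" using y I_eq by auto
  then have 2: "(y * u) ^ r = y * u ^ r" for u by (simp add: power_mult_distrib)
  show ?thesis unfolding 1 2 by (rule distrib_left[symmetric])
qed

lemma trace_char_J: "trace_char (2 * g) (u :: 'a) = trace_char g (u + u ^ r)"
  using trace_char_mult[of g 2 u] by (simp add: r_def mult.commute numeral_2_eq_2)

lemma W_eq_f:
  assumes b: "b \<in> J" shows "J.W b = (\<Sum>x\<in>J. trace_char (2 * g) (x ^ f + b * x))"
  unfolding J.W_eq[OF b]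
proof (rule sum.cong[OF refl])
  fix x assume x: "x \<in> J"
  have "trace_char (2 * g) (x ^ f) = trace_char (2 * g) (x ^ e)"
    using J.trace_char_frobenius[of "x ^ e" k] x by (simp add: f_def power_mult)
  then show "trace_char (2 * g) (x ^ e) * trace_char (2 * g) (b * x) = trace_char (2 * g) (x ^ f + b * x)"
    using x b by (simp add: J.trace_char_add)
qed

text \<open>Averaging over the substitutions \<open>y * x\<close> with \<open>y\<close> in
  \<open>I - {0}\<close> produces character sums over \<open>I\<close>: r - 1 where the relative
  trace vanishes, -1 elsewhere. The total is r |zeros| - r^2.\<close>

lemma W_eq_w:
  assumes b: "b \<in> J" shows "of_nat (r - 1) * J.W b = of_nat r * of_int (w b)"
proof -
  let ?u = "\<lambda>x. x ^ f + b * x"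
  have scale: "J.W b = (\<Sum>x\<in>J. trace_char g (y * (?u x + ?u x ^ r)))" if y: "y \<in> I - {0}" for y
  proof -
    have "J.W b = (\<Sum>x\<in>J. trace_char (2 * g) (?u (y * x)))"
      unfolding W_eq_f[OF b]
      by (rule sum.reindex_bij_witness[where i = "\<lambda>x. y * x" and j = "\<lambda>x. inverse y * x"])
         (use y I_subset in \<open>auto simp flip: mult.assoc\<close>)
    also have "\<dots> = (\<Sum>x\<in>J. trace_char g (y * (?u x + ?u x ^ r)))"
    proof (rule sum.cong[OF refl])
      fix x
      show "trace_char (2 * g) (?u (y * x)) = trace_char g (y * (?u x + ?u x ^ r))"
        unfolding trace_char_J using scale_I[of y x b] y by simp
    qed
    finally show ?thesis .
  qed
  have "of_nat (r - 1) * J.W b = (\<Sum>y\<in>I - {0}. J.W b)"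
    by (simp add: card_Diff_singleton card_I)
  also have "\<dots> = (\<Sum>y\<in>I - {0}. \<Sum>x\<in>J. trace_char g (y * (?u x + ?u x ^ r)))"
    by (rule sum.cong[OF refl scale])
  also have "\<dots> = (\<Sum>x\<in>J. \<Sum>y\<in>I - {0}. trace_char g (y * (?u x + ?u x ^ r)))"
    by (rule sum.swap)
  also have "\<dots> = (\<Sum>x\<in>J. (if ?u x + ?u x ^ r = 0 then of_nat r else 0) - 1)"
  proof (rule sum.cong[OF refl])
    fix x assume x: "x \<in> J"
    have T: "?u x + ?u x ^ r \<in> I" using x b by (intro rel_trace_in_I) simp
    have "(\<Sum>y\<in>I. trace_char g ((?u x + ?u x ^ r) * y))
        = 1 + (\<Sum>y\<in>I - {0}. trace_char g ((?u x + ?u x ^ r) * y))"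
      using sum.remove[of I 0 "\<lambda>y. trace_char g ((?u x + ?u x ^ r) * y)"] by simp
    with I.sum_trace_char[OF T]
    have "1 + (\<Sum>y\<in>I - {0}. trace_char g ((?u x + ?u x ^ r) * y))
        = (if ?u x + ?u x ^ r = 0 then of_nat r else 0)" unfolding card_I by (rule trans[OF sym, rotated])
    then show "(\<Sum>y\<in>I - {0}. trace_char g (y * (?u x + ?u x ^ r)))
        = (if ?u x + ?u x ^ r = 0 then of_nat r else 0) - 1"
      by (simp only: eq_diff_eq add.commute mult.commute)
  qed
  also have "\<dots> = (\<Sum>x\<in>J. if ?u x + ?u x ^ r = 0 then of_nat r else 0) - of_nat (card J)"
    by (simp only: sum_subtractf) simp
  also have "(\<Sum>x\<in>J. if ?u x + ?u x ^ r = 0 then of_nat r else 0) = (\<Sum>x\<in>zeros b. of_nat r)"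
    unfolding zeros_def by (rule sum.inter_filter[symmetric]) simp
  finally show ?thesis by (simp add: w_def card_J power2_eq_square algebra_simps)
qed

lemma W_eq_w': "b \<in> J \<Longrightarrow> of_int (w b) = of_nat (r - 1) / of_nat r * J.W b"
  using W_eq_w[of b] r_gt_1 by (simp add: field_simps)

lemma sum_w: "(\<Sum>b\<in>J. w b) = int ((r - 1) * r)"
proof -
  have "complex_of_int (\<Sum>b\<in>J. w b) = of_nat (r - 1) / of_nat r * (\<Sum>b\<in>J. J.W b)"
    by (simp add: W_eq_w' sum_distrib_left)
  also have "\<dots> = of_int (int ((r - 1) * r))"
    using r_gt_1 by (simp add: J.sum_W card_J power2_eq_square)
  finally show ?thesis by (simp only: of_int_eq_iff)
qed

lemma sum_w_square: "(\<Sum>b\<in>J. w b ^ 2) = int ((r - 1) * r) ^ 2"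
proof -
  have "complex_of_int (\<Sum>b\<in>J. w b ^ 2) = (of_nat (r - 1) / of_nat r) ^ 2 * (\<Sum>b\<in>J. J.W b ^ 2)"
    by (simp add: W_eq_w' sum_distrib_left power_mult_distrib power_divide)
  also have "\<dots> = of_int (int ((r - 1) * r) ^ 2)"
    unfolding J.sum_W_square card_J using r_gt_1 by (simp add: field_simps power2_eq_square)
  finally show ?thesis by (simp only: of_int_eq_iff)
qed

lemma w_0: "w 0 = 0"
  using W_eq_w'[of 0] J.W_0 by simp

text \<open>The nonzero zeros are permuted freely by the multiplicative group of \<open>I\<close>.\<close>

lemma card_zeros_ge:
  assumes b: "b \<in> J" and x: "x \<in> zeros b" "x \<noteq> 0" shows "r \<le> card (zeros b)"
proof -
  have "(\<lambda>y. y * x) ` I \<subseteq> zeros b"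
  proof clarify
    fix y assume y: "y \<in> I"
    show "y * x \<in> zeros b"
      using scale_I[OF y, of x b] x(1) y I_subset unfolding zeros_def by auto
  qed
  then have "card ((\<lambda>y. y * x) ` I) \<le> card (zeros b)" by (intro card_mono) auto
  moreover have "card ((\<lambda>y. y * x) ` I) = r"
    using x(2) by (subst card_image) (auto simp: inj_on_def card_I)
  ultimately show ?thesis by simp
qed

text \<open>As p divides r, it divides the number of zeros, which is positive because 0 is a zero.
  So a nonzero zero exists, and with it a whole line over \<open>I\<close>.\<close>

lemma w_nonneg:
  assumes b: "b \<in> J" and dvd: "int CHAR('a) dvd w b" shows "w b \<ge> 0"
proof -
  have p: "prime CHAR('a)" by (rule prime_CHAR_finite)
  have f_pos: "f > 0" using J.e_pos p by (simp add: f_def prime_gt_0_nat)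
  have 0: "0 \<in> zeros b" using f_pos r_gt_1 by (simp add: zeros_def power_0_left)
  have "CHAR('a) dvd r" using I.h_pos by (simp add: r_def)
  then have "int CHAR('a) dvd int (card (zeros b))"
    using dvd unfolding w_def by (metis diff_add_cancel dvd_add of_nat_dvd_iff)
  then have "CHAR('a) dvd card (zeros b)" by simp
  moreover have "card (zeros b) \<noteq> 0" using 0 by (auto simp: card_eq_0_iff)
  ultimately have "card (zeros b) \<ge> CHAR('a)" by (intro dvd_imp_le) auto
  then have "card (zeros b) \<ge> 2" using prime_ge_2_nat[OF p] by simp
  then have "\<not> zeros b \<subseteq> {0}" using card_mono[of "{0}" "zeros b"] by force
  then obtain x where "x \<in> zeros b" "x \<noteq> 0" by blast
  from card_zeros_ge[OF b this] show ?thesis by (simp add: w_def)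
qed

text \<open>If all \<open>w b\<close> were below S, nonnegativity would bound the sum of squares by
  (S - 1) S, but it is S^2. A value of at least S means at least S + r = |J| zeros.\<close>

lemma all_zeros:
  assumes dvd: "\<And>b. b \<in> J \<Longrightarrow> int CHAR('a) dvd w b"
  shows "\<exists>b\<in>J. zeros b = J"
proof -
  let ?S = "int ((r - 1) * r)"
  have S: "?S > 0" using r_gt_1 by simp
  have "\<exists>b\<in>J. w b \<ge> ?S"
  proof (rule ccontr)
    assume "\<not> ?thesis"
    then have le: "w b \<le> ?S - 1" if "b \<in> J" for b using that by force
    have "?S ^ 2 = (\<Sum>b\<in>J. w b * w b)" using sum_w_square by (simp add: power2_eq_square)
    also have "\<dots> \<le> (\<Sum>b\<in>J. (?S - 1) * w b)"
      by (intro sum_mono mult_right_mono le w_nonneg dvd)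
    also have "\<dots> = (?S - 1) * ?S" using sum_w by (simp only: sum_distrib_left[symmetric])
    also have "\<dots> < ?S ^ 2" using S by (simp add: power2_eq_square algebra_simps)
    finally show False by simp
  qed
  then obtain b where b: "b \<in> J" "w b \<ge> ?S" by blast
  have "int ((r - 1) * r) + int r = int (card J)"
    using r_gt_1 by (simp add: card_J power2_eq_square algebra_simps of_nat_diff)
  then have "card J \<le> card (zeros b)" using b(2) by (simp add: w_def)
  then have "zeros b = J" by (intro card_seteq) (auto simp: zeros_def)
  with b(1) show ?thesis by blast
qed

theorem exponent_is_frobenius:
  assumes dvd: "\<And>b. b \<in> J \<Longrightarrow> int CHAR('a) dvd w b"
  shows "\<exists>j. [f = CHAR('a) ^ j] (mod card J - 1)"
proof -
  obtain b where b: "b \<in> J" "zeros b = J" using all_zeros[OF dvd] by blast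
  let ?n = "card J - 1" and ?c = "f mod (card J - 1)" and ?c' = "f * r mod (card J - 1)"
  interpret G: finite_mult_group "J - {0}" by (rule finite_mult_group_subfield[OF J.subfield])
  have cG: "card (J - {0}) = ?n" by (simp add: card_Diff_singleton)
  have rn: "1 < ?n" "r < ?n"
  proof -
    have "r * 2 \<le> r * r" using r_gt_1 by (intro mult_left_mono) auto
    then have "r * 2 \<le> card J" by (simp add: card_J power2_eq_square)
    then show "1 < ?n" "r < ?n" using r_gt_1 by auto
  qed
  \<comment> \<open>The relative trace of x^f + b x, expanded, with exponents reduced modulo |J| -
    1. It vanishes at all |J| - 1 units but has smaller degree, so it is zero.\<close>
  define P where "P = Polynomial.monom 1 ?c + Polynomial.monom b 1 + Polynomial.monom 1 ?c' + Polynomial.monom (b ^ r) r"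
  have "P = 0"
  proof (rule ccontr)
    assume nz: "P \<noteq> 0"
    have "poly P x = 0" if x: "x \<in> J - {0}" for x
    proof -
      have pc: "x ^ ?n = 1" using G.power_card[OF x] unfolding cG .
      have "x ^ ?c = x ^ f" "x ^ ?c' = x ^ (f * r)"
        by (rule power_eq_of_cong[OF pc]; simp add: cong_def)+
      then have "poly P x = (x ^ f + b * x) + (x ^ f + b * x) ^ r"
        by (simp add: P_def poly_monom frob_r_add power_mult power_mult_distrib)
      also have "\<dots> = 0" using x b(2) by (auto simp: zeros_def)
      finally show ?thesis .
    qed
    then have "card (J - {0}) \<le> card {x. poly P x = 0}"
      by (intro card_mono) auto
    also have "\<dots> \<le> Polynomial.degree P" by (rule card_poly_roots_bound[OF nz])
    also have "\<dots> \<le> ?n - 1"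
    proof -
      have "?c < ?n" "?c' < ?n" using rn by (auto intro!: mod_less_divisor)
      then have "?c \<le> ?n - 1" "?c' \<le> ?n - 1" by linarith+
      then show ?thesis unfolding P_def using rn
        by (intro degree_add_le order_trans[OF degree_monom_le]) auto
    qed
    finally show False using rn cG by simp
  qed
  \<comment> \<open>Equal exponents would put every \<open>x ^ f\<close> into the smaller field
    \<open>I\<close>, against injectivity of this power on \<open>J\<close>.\<close>
  have "?c' \<noteq> ?c"
  proof
    assume eq: "?c' = ?c"
    have "(x ^ f) ^ r = x ^ f" if x: "x \<in> J" for x
    proof (cases "x = 0")
      case False
      then have pc: "x ^ ?n = 1" using G.power_card[of x] x unfolding cG by simp
      have "x ^ (f * r) = x ^ f" by (rule power_eq_of_cong[OF pc]) (use eq in \<open>simp add: cong_def\<close>)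
      then show ?thesis by (simp add: power_mult)
    next
      case True
      then show ?thesis using r_gt_1 by (cases "f = 0") (auto simp: power_0_left)
    qed
    then have "(\<lambda>x. x ^ f) ` J \<subseteq> I" using I_eq by auto
    moreover have "inj_on (\<lambda>x. x ^ f) J"
    proof (rule inj_onI)
      fix x y assume xy: "x \<in> J" "y \<in> J" "x ^ f = y ^ f"
      then have "x ^ e = y ^ e"
        using power_CHAR_power_inj[OF prime_CHAR_finite, of "x ^ e" k "y ^ e"]
        by (simp add: f_def power_mult)
      with xy show "x = y" using J.bij by (auto simp: bij_betw_def inj_on_def)
    qed
    ultimately have "card J \<le> card I" by (intro card_inj_on_le) auto
    then show False using r_gt_1 rn by (simp add: card_I)
  qed
  \<comment> \<open>The leading 1 at \<open>?c\<close> can now be cancelled only by \<open>b\<close>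
    at exponent 1 or \<open>b ^ r\<close> at exponent \<open>r\<close>; these exponents are p^0 and
    p^g.\<close>
  have "Polynomial.coeff P ?c = 0" using \<open>P = 0\<close> by simp
  with \<open>?c' \<noteq> ?c\<close> have "?c = 1 \<or> ?c = r" by (auto simp: P_def split: if_splits)
  then have "[f = CHAR('a) ^ 0] (mod ?n) \<or> [f = CHAR('a) ^ g] (mod ?n)"
    using rn by (auto simp: cong_def r_def)
  then show ?thesis by blast
qed

end

section \<open>Symmetric three-valued Weil sums\<close>

text \<open>Write W = A s. As s^3 = s, the third moment is A^2 times the first, which gives A^2 = q
  M with M the count from \<open>sum_W_cube\<close>. The other moments then read M C = q and M D^2 =
  q. As q is the square of r^m, D divides r^m, and B = r^m / D satisfies B^2 = M and A = r^m
  B.\<close>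

lemma (in extension) symmetric_three_valued_dvd:
  assumes image: "K.W ` (UNIV - {0}) = {- A, 0, A}" and Q: "Q = r ^ 2"
  shows "\<exists>u. \<forall>a. K.W a = of_nat (r ^ m) * of_int (int CHAR('a) * u a)"
proof -
  let ?q = "CARD('a)" and ?p = "CHAR('a)"
  define M where "M = card {x :: 'a. x ^ e + 1 = (x + 1) ^ e}"
  define s :: "'a \<Rightarrow> int" where "s = (\<lambda>a. if K.W a = 0 then 0 else if K.W a = A then 1 else - 1)"
  have W: "K.W a = A * of_int (s a)" for a
  proof (cases "a = 0")
    case False
    then have "K.W a \<in> {- A, 0, A}" using image by blast
    then show ?thesis by (auto simp: s_def)
  qed (simp add: s_def K.W_0)
  have s3: "s a ^ 3 = s a" for a by (auto simp: s_def)
  define D C where "D = (\<Sum>a\<in>UNIV. s a)" and "C = (\<Sum>a\<in>UNIV. s a ^ 2)"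
  have q0: "complex_of_nat ?q \<noteq> 0" by simp
  have 1: "A * of_int D = of_nat ?q"
    using K.sum_W by (simp add: W D_def sum_distrib_left)
  have 2: "A ^ 2 * of_int C = of_nat ?q ^ 2"
    using K.sum_W_square by (simp add: W C_def sum_distrib_left power_mult_distrib)
  have 3: "A ^ 2 = of_nat ?q * of_nat M"
  proof -
    have "(\<Sum>a\<in>UNIV. K.W a ^ 3) = A ^ 3 * of_int (\<Sum>a\<in>UNIV. s a ^ 3)"
      by (simp add: W sum_distrib_left power_mult_distrib)
    also have "\<dots> = A ^ 2 * (A * of_int D)"
      unfolding s3 D_def by (simp add: power3_eq_cube power2_eq_square)
    finally have "of_nat ?q * A ^ 2 = of_nat ?q * (of_nat ?q * of_nat M)"
      using K.sum_W_cube by (simp add: 1 M_def power2_eq_square mult_ac)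
    then show ?thesis using q0 by (simp only: mult_cancel_left simp_thms)
  qed
  have MC: "int M * C = int ?q"
  proof -
    have "of_nat ?q * of_int (int M * C) = of_nat ?q * complex_of_int (int ?q)"
      using 2 unfolding 3 by (simp add: power2_eq_square mult.assoc)
    then show ?thesis using q0 by (simp only: mult_cancel_left of_int_eq_iff simp_thms)
  qed
  have MD: "int M * D ^ 2 = int ?q"
  proof -
    have "(A * of_int D) ^ 2 = of_nat ?q * of_int (int M * D ^ 2)"
      by (simp add: power_mult_distrib 3)
    then have "of_nat ?q * of_int (int M * D ^ 2) = of_nat ?q * complex_of_int (int ?q)"
      unfolding 1 by (simp add: power2_eq_square)
    then show ?thesis using q0 by (simp only: mult_cancel_left of_int_eq_iff simp_thms)
  qed
  \<comment> \<open>Strict because \<open>s\<close> vanishes at 0; this excludes M = 1.\<close>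
  have "C < int ?q"
  proof -
    have "C = (\<Sum>a\<in>UNIV - {0}. s a ^ 2)"
      unfolding C_def by (rule sum.mono_neutral_right) (auto simp: s_def K.W_0)
    also have "\<dots> \<le> (\<Sum>a\<in>UNIV - {0 :: 'a}. 1)"
      by (rule sum_mono) (auto simp: s_def)
    also have "\<dots> < int ?q" by (simp add: card_Diff_singleton)
    finally show ?thesis .
  qed
  with MC have M1: "M \<noteq> 1" by auto
  have p: "prime ?p" by (rule prime_CHAR_finite)
  have "int M dvd int ?q" unfolding MC[symmetric] by simp
  then have "M dvd ?p ^ (h * m)" unfolding K.card_F[symmetric] by (simp only: of_nat_dvd_iff)
  then obtain i where "M = ?p ^ i" unfolding divides_primepow_nat[OF p] by blast
  with M1 have pM: "?p dvd M" by (cases i) auto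
  have qr: "int ?q = int (r ^ m) ^ 2"
    using card_UNIV_eq Q by (simp add: power_mult[symmetric] mult.commute)
  have "D ^ 2 dvd int (r ^ m) ^ 2" unfolding qr[symmetric] MD[symmetric] by simp
  then have "D dvd int (r ^ m)" by (simp add: pow_divides_pow_iff)
  then obtain B where B: "int (r ^ m) = D * B" by blast
  have D0: "D \<noteq> 0" using MD by auto
  have "int M * D ^ 2 = B ^ 2 * D ^ 2"
    unfolding MD qr B by (simp add: power_mult_distrib mult.commute)
  then have "int M = B ^ 2" using D0 by simp
  moreover have "int ?p dvd int M" using pM by (simp only: of_nat_dvd_iff)
  ultimately have "int ?p dvd B ^ 2" by simp
  then have "int ?p dvd B" using p by (simp add: prime_dvd_power_iff)
  then obtain B' where B': "B = int ?p * B'" by blast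
  have "A * of_int D = of_int (int ?q)" using 1 by simp
  also have "\<dots> = (of_nat (r ^ m) * of_int B) * of_int D"
    unfolding qr power2_eq_square of_int_mult of_int_of_nat_eq
    by (subst (2) of_int_of_nat_eq[symmetric], subst B) (simp add: mult_ac)
  finally have A: "A = of_nat (r ^ m) * of_int B" using D0 by simp
  show ?thesis
    by (intro exI[of _ "\<lambda>a. B' * s a"]) (simp add: W A B' mult_ac)
qed

locale niho_extension = niho I J g e k + extension J "2 * g" m e
  for I J :: "'a::{finite,field} set" and g e k m :: nat
begin

text \<open>The fibre sums make the convolution power of \<open>J.W\<close> divisible by p r^m.
  Passing to \<open>w\<close> multiplies it by ((r - 1) / r)^m, which removes r^m and leaves
  p.\<close>

lemma dvd_w:
  assumes u: "\<And>a. K.W a = of_nat (r ^ m) * of_int (int CHAR('a) * u a)"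
    and b: "b \<in> J"
  shows "int CHAR('a) dvd w b"
proof (cases "b = 0")
  case False
  let ?G = "J - {0}" and ?p = "CHAR('a)"
  have r0: "r > 0" using r_gt_1 by simp
  have dvd: "int ?p dvd conv_pow ?G w m t" if t: "t \<in> ?G" for t
  proof -
    define U where "U = (\<Sum>a | N a = t. u a)"
    have "conv_pow ?G J.W m t = of_nat (r ^ m) * of_int (int ?p * U)"
      unfolding sum_N_fibre_W[OF t, symmetric] u U_def by (simp add: sum_distrib_left)
    moreover have "complex_of_int (conv_pow ?G w m t)
        = conv_pow ?G (\<lambda>b. of_nat (r - 1) / of_nat r * J.W b) m t"
      unfolding conv_pow_of_int[symmetric] by (rule G.conv_pow_cong[OF _ t]) (simp add: W_eq_w')
    ultimately have "complex_of_int (conv_pow ?G w m t)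
        = (of_nat (r - 1) / of_nat r) ^ m * (of_nat (r ^ m) * of_int (int ?p * U))"
      by (simp only: G.conv_pow_scale[OF t])
    also have "\<dots> = of_int (int (r - 1) ^ m * (int ?p * U))"
      using r0 by (simp add: power_divide)
    finally have "conv_pow ?G w m t = int (r - 1) ^ m * (int ?p * U)"
      by (simp only: of_int_eq_iff)
    then show ?thesis by simp
  qed
  \<comment> \<open>In characteristic p the m-th power of this Fourier coefficient is that of the
    convolution power, hence 0.\<close>
  have zero: "(\<Sum>t\<in>?G. t ^ j * of_int (w t)) = (0 :: 'a)" for j
  proof -
    have "(\<Sum>t\<in>?G. t ^ j * of_int (w t)) ^ m = (\<Sum>t\<in>?G. t ^ j * conv_pow ?G (\<lambda>b. of_int (w b)) m t)"
      by (rule G.sum_conv_pow[symmetric]) (simp_all add: power_mult_distrib)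
    also have "\<dots> = 0"
    proof (rule sum.neutral, rule ballI)
      fix t assume "t \<in> ?G"
      then have "(of_int (conv_pow ?G w m t) :: 'a) = 0"
        using dvd by (simp add: of_int_eq_0_iff_char_dvd)
      then show "t ^ j * conv_pow ?G (\<lambda>b. of_int (w b)) m t = 0"
        by (simp add: conv_pow_of_int)
    qed
    finally show ?thesis by simp
  qed
  \<comment> \<open>The order |J| - 1 is -1 modulo p.\<close>
  have "of_nat (card ?G) \<noteq> (0 :: 'a)"
  proof
    assume "of_nat (card ?G) = (0 :: 'a)"
    then have "?p dvd card ?G" by (simp add: of_nat_eq_0_iff_char_dvd)
    moreover have "?p dvd card J" using J.h_pos J.card_F by simp
    moreover have "card J = card ?G + 1"
      using r0 by (simp add: card_Diff_singleton card_J)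
    ultimately have "?p dvd 1" using dvd_add_right_iff by metis
    then show False using prime_CHAR_finite[where ?'a='a] by auto
  qed
  from G.fourier_vanish[OF this zero, of b] False b have "(of_int (w b) :: 'a) = 0" by simp
  then show ?thesis by (simp add: of_int_eq_0_iff_char_dvd)
qed (simp add: w_0)

end

section \<open>From the integer exponent to a natural one, and the conclusion\<close>

lemma power_card_minus_1:
  fixes x :: "'a::{finite,field}"
  assumes "x \<noteq> 0" shows "x ^ (CARD('a) - 1) = 1"
proof -
  interpret finite_mult_group "UNIV - {0 :: 'a}"
    by (rule finite_mult_group_subfield[OF subfield_UNIV])
  show ?thesis using power_card[of x] assms by (simp add: card_Diff_singleton)
qed

lemma weil_exponentI:
  fixes F :: "'a::{finite,field} set"
  assumes F: "Defs.subfield F" "card F = CHAR('a) ^ h" and e: "e > 0" "coprime e (CARD('a) - 1)"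
  shows "weil_exponent F h e"
proof -
  interpret finite_subfield F h by unfold_locales (rule F)+
  obtain l where l: "[e * l = 1] (mod (CARD('a) - 1))"
    using cong_solve_coprime_nat[OF e(2)] by (metis One_nat_def)
  have recover: "(x ^ e) ^ l = x" if "x \<noteq> 0" for x :: 'a
    using power_eq_of_cong[OF power_card_minus_1[OF that] l] by (simp add: power_mult)
  have inj: "inj_on (\<lambda>x. x ^ e) F"
  proof (rule inj_onI)
    fix x y :: 'a assume eq: "x ^ e = y ^ e"
    then have "x = 0 \<longleftrightarrow> y = 0" using e(1) by (metis power_eq_0_iff)
    then show "x = y" using recover[of x] recover[of y] unfolding eq by (cases "y = 0") auto
  qed
  show ?thesis
  proof
    show "e > 0" by (rule e)
    have "(\<lambda>x. x ^ e) ` F \<subseteq> F" by auto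
    from endo_inj_surj[OF finite this inj] inj show "bij_betw (\<lambda>x. x ^ e) F F"
      by (simp only: bij_betw_def)
    fix x assume "x \<in> F"
    show "(- x) ^ e = - (x ^ e)"
    \<comment> \<open>For even \<open>e\<close> coprimality makes |K| - 1 odd, so (-1)^(|K|-1) is
      both -1 and 1, and signs disappear.\<close>
    proof (cases "even e")
      case True
      have "odd (CARD('a) - 1)"
      proof
        assume "even (CARD('a) - 1)"
        from coprime_common_divisor[OF e(2) True this] show False by simp
      qed
      then have "(- 1 :: 'a) ^ (CARD('a) - 1) = - 1" by (rule neg_one_odd_power)
      moreover have "(- 1 :: 'a) ^ (CARD('a) - 1) = 1" by (rule power_card_minus_1) simp
      ultimately have m1: "(- 1 :: 'a) = 1" by simp
      have neg: "- z = z" for z :: 'a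
        using arg_cong[OF m1, of "\<lambda>c. c * z"] by (simp only: mult_minus1 mult_1)
      show ?thesis by (simp only: neg)
    qed simp
  qed
qed

theorem theorem1p4:
  fixes d :: int and I J :: "'a::{finite,field} set"
  assumes "gcd d (int CARD('a) - 1) = 1"
    and "subfield I" and "subfield J" and "I \<subseteq> J"
    and "card J = (card I)^2"
    and "degenerate d I" and "\<not> degenerate d J"
  shows "\<not> (\<exists>A::complex. (weil_sum d :: 'a \<Rightarrow> complex) ` (UNIV - {0}) = {-A, 0, A})"
proof
  let ?p = "CHAR('a)" and ?q = "CARD('a)"
  assume "\<exists>A::complex. (weil_sum d :: 'a \<Rightarrow> complex) ` (UNIV - {0}) = {-A, 0, A}"
  then obtain A where A: "(weil_sum d :: 'a \<Rightarrow> complex) ` (UNIV - {0}) = {-A, 0, A}" by blast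
  obtain g where g: "g > 0" "card I = ?p ^ g" using card_subfield[OF assms(2)] by blast
  have cJ: "card J = ?p ^ (2 * g)" using assms(5) g by (simp add: power_mult[symmetric] mult.commute)
  have I2: "card I \<ge> 2" by (rule card_subfield_ge_2[OF assms(2)])
  have "\<exists>m. card (UNIV :: 'a set) = card J ^ m"
    by (rule card_subspace_power[OF assms(3)]) auto
  then obtain m where m: "?q = card J ^ m" by blast
  have q: "?q = ?p ^ (2 * g * m)" using m cJ by (simp add: power_mult)
  have q_I: "?q = card I ^ (2 * m)" using m assms(5) by (simp add: power_mult)
  have m_pos: "m > 0" using m card_subfield_ge_2[OF subfield_UNIV[where ?'a='a]] by (cases m) auto
  have dvd: "c - 1 dvd c ^ n - 1" if "c \<ge> 1" for c n :: nat
  proof -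
    have "int (c ^ n - 1) = int (c - 1) * (\<Sum>i<n. int c ^ i)"
      using that power_diff_1_eq[of "int c" n] by (simp add: of_nat_diff)
    then have "int (c - 1) dvd int (c ^ n - 1)" by (metis dvd_triv_left)
    then show ?thesis by simp
  qed
  have dvdI: "card I - 1 dvd ?q - 1" using dvd[of "card I" "2 * m"] I2 unfolding q_I by simp
  have J4: "card J \<ge> 4" using I2 mult_le_mono[OF I2 I2] by (simp add: assms(5) power2_eq_square)
  have dvdJ: "card J - 1 dvd ?q - 1" using dvd[of "card J" m] J4 unfolding m by simp
  have q4: "?q \<ge> 4" using J4 card_mono[of UNIV J] by simp
  \<comment> \<open>The summand \<open>?q - 1\<close> keeps the residue class and makes the exponent
    positive outright, so that \<open>0 ^ e = 0\<close>.\<close>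
  define e where "e = nat (d mod (int ?q - 1)) + (?q - 1)"
  have e_pos: "e > 0" using q4 by (simp add: e_def)
  have ed: "[int e = d] (mod (int ?q - 1))"
  proof -
    have "int e = d mod (int ?q - 1) + (int ?q - 1)" using q4 by (simp add: e_def of_nat_diff)
    then show ?thesis by (simp only: cong_def mod_add_self2 mod_mod_trivial)
  qed
  have "coprime (int e) (int ?q - 1)"
  proof -
    have "coprime d (int ?q - 1)" using assms(1) by (simp add: coprime_iff_gcd_eq_1)
    then show ?thesis using cong_imp_coprime[OF cong_sym[OF ed]] by simp
  qed
  then have "coprime (int e) (int (?q - 1))" using q4 by (simp add: of_nat_diff)
  then have cop: "coprime e (?q - 1)" by (simp only: coprime_int_iff)
  \<comment> \<open>\<open>d = 0\<close> would give a gcd of at least 3. For nonzero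
    \<open>d\<close>, even negative, \<open>0 powi d = 0\<close> agrees with
    \<open>0 ^ e\<close>.\<close>
  have d0: "d \<noteq> 0" using assms(1) q4 by auto
  have pow: "x powi d = x ^ e" for x :: 'a
  proof (cases "x = 0")
    case True
    then show ?thesis using d0 e_pos by (simp add: power_int_0_left_if)
  next
    case False
    have "int ?q - 1 dvd d - int e" using cong_sym[OF ed] by (simp only: cong_iff_dvd_diff)
    then obtain z where "d = int e + int (?q - 1) * z"
      using q4 by (auto simp: dvd_def of_nat_diff algebra_simps)
    then have "x powi d = x ^ e * (x ^ (?q - 1)) powi z"
      using False by (simp only: power_int_add power_int_mult power_int_of_nat simp_thms)
    then show ?thesis unfolding power_card_minus_1[OF False] by simp
  qed
  have econg: "[int e = d] (mod int (card F) - 1)" if "card F - 1 dvd ?q - 1" "card F \<ge> 1" for F :: "'a set"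
  proof -
    have "int (card F - 1) dvd int (?q - 1)" using that(1) by (simp only: of_nat_dvd_iff)
    then have "int (card F) - 1 dvd int ?q - 1" using that(2) q4 by (simp add: of_nat_diff)
    with ed show ?thesis by (rule cong_dvd_modulus)
  qed
  from assms(6) obtain j where "[d = int ?p ^ j] (mod int (card I) - 1)"
    unfolding degenerate_def by blast
  moreover have "[int e = d] (mod int (card I) - 1)" using I2 by (intro econg dvdI) simp
  ultimately have "[int e = int ?p ^ j] (mod int (card I) - 1)" by (rule cong_trans[rotated])
  then have "[int e = int (?p ^ j)] (mod int (card I - 1))" using I2 by (simp add: of_nat_diff)
  then have ej: "[e = ?p ^ j] (mod card I - 1)" by (simp only: cong_int_iff)
  have power_1: "[c ^ n = 1] (mod c - 1)" if "c \<ge> 1" for c n :: nat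
    using dvd[OF that, of n] that by (simp add: cong_altdef_nat)
  \<comment> \<open>Chosen so that p^j p^k = |I|^j, which is 1 modulo |I| - 1: multiplication by p^k
    undoes the factor p^j without negative exponents.\<close>
  define k where "k = (g - 1) * j"
  have "[e * ?p ^ k = ?p ^ j * ?p ^ k] (mod card I - 1)" using ej by (rule cong_mult) simp
  also have "?p ^ j * ?p ^ k = card I ^ j"
    using g(1) unfolding g(2) k_def by (simp add: power_add[symmetric] power_mult[symmetric] algebra_simps)
  also have "[card I ^ j = 1] (mod card I - 1)" using power_1 I2 by simp
  finally have f1: "[e * ?p ^ k = 1] (mod card I - 1)" .
  have fixes_I: "y ^ (e * ?p ^ k) = y" if y: "y \<in> I" for y
  proof (cases "y = 0")
    case True
    then show ?thesis using e_pos prime_gt_0_nat[OF prime_CHAR_finite[where ?'a='a]] by simp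
  next
    case False
    interpret G: finite_mult_group "I - {0}" by (rule finite_mult_group_subfield[OF assms(2)])
    have "y ^ (card I - 1) = 1"
      using G.power_card[of y] False y subfieldD(1)[OF assms(2)] by (simp add: card_Diff_singleton)
    from power_eq_of_cong[OF this f1] show ?thesis by simp
  qed
  interpret niho_extension I J g e k m
  proof -
    interpret I: finite_subfield I g by unfold_locales (rule assms g)+
    interpret J: weil_exponent J "2 * g" e by (rule weil_exponentI[OF assms(3) cJ e_pos cop])
    interpret K: weil_exponent "UNIV :: 'a set" "2 * g * m" e
      by (rule weil_exponentI[OF subfield_UNIV q e_pos cop])
    show "niho_extension I J g e k m"
      by unfold_locales (use assms(4) fixes_I in auto)
  qed
  have W: "weil_sum d = K.W"
    unfolding weil_sum_def K.W_def pow psi_eq_trace_char[OF q] ..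
  have "Q = r ^ 2" unfolding Q_def r_def power_mult[symmetric] by (simp only: mult.commute)
  from symmetric_three_valued_dvd[OF A[unfolded W] this] obtain u
    where "\<And>a. K.W a = of_nat (r ^ m) * of_int (int ?p * u a)" by blast
  then have "int ?p dvd w b" if "b \<in> J" for b using dvd_w that by blast
  then obtain i where i: "[f = ?p ^ i] (mod card J - 1)" using exponent_is_frobenius by blast
  \<comment> \<open>Likewise p^k p^l = |J|^k is 1 modulo |J| - 1, which leads from \<open>f\<close>
    back to \<open>e\<close>.\<close>
  define l where "l = (2 * g - 1) * k"
  have "?p ^ k * ?p ^ l = card J ^ k"
    using g(1) unfolding cJ l_def by (simp add: power_add[symmetric] power_mult[symmetric] algebra_simps)
  then have "[e * (?p ^ k * ?p ^ l) = e * 1] (mod card J - 1)"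
    using power_1[of "card J" k] J4 by (intro cong_mult) auto
  then have "[e = e * (?p ^ k * ?p ^ l)] (mod card J - 1)" by (simp add: cong_sym_eq)
  also have "e * (?p ^ k * ?p ^ l) = f * ?p ^ l" by (simp add: f_def)
  also have "[f * ?p ^ l = ?p ^ i * ?p ^ l] (mod card J - 1)" using i by (rule cong_mult) simp
  finally have "[e = ?p ^ (i + l)] (mod card J - 1)" by (simp add: power_add)
  then have "[int e = int (?p ^ (i + l))] (mod int (card J - 1))" by (simp only: cong_int_iff)
  then have "[int e = int ?p ^ (i + l)] (mod int (card J) - 1)" using J4 by (simp add: of_nat_diff)
  moreover have "[d = int e] (mod int (card J) - 1)" using J4 by (intro cong_sym[OF econg] dvdJ) simp
  ultimately have "[d = int ?p ^ (i + l)] (mod int (card J) - 1)" by (rule cong_trans[rotated])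
  then show False using assms(7) unfolding degenerate_def by blast
qed

end
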